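(* Fix $t\in(0,1)$ and consider the adjusted conditional multiple testing procedure with threshold $t$. For each $m\ge 1$ let $\boldsymbol{\zeta}_m=\boldsymbol{\mu}_m+\boldsymbol{\eta}_m+\mathbf{v}_m$, where $\boldsymbol{\mu}_m\in\mathbb{R}^m$ and $\boldsymbol{\eta}_m\sim\mathsf{N}_m(\mathbf{0},\boldsymbol{\Sigma}_{\boldsymbol{\eta}})$ and $\mathbf{v}_m\sim\mathsf{N}_m(\mathbf{0},\boldsymbol{\Sigma}_{\mathbf{v}})$ are independent. Let $\mathbf{R}_{\mathbf{v}}$ be the correlation matrix of $\mathbf{v}_m$, $\boldsymbol{\sigma}_{\mathbf{v},m}=(\sigma_{1,m},\ldots,\sigma_{m,m})$ the vector of standard deviations of the components of $\mathbf{v}_m$, and $\sigma_0=\lim_{m\to\infty}\min\{\sigma_{i,m}:\sigma_{i,m}\ne 0,\ 1\le i\le m\}$. Assume $\sigma_0>0$ and $m^{-2}\|\mathbf{R}_{\mathbf{v}}\|_1=O(m^{-\delta})$ for some $\delta>0$. If for any natural numbers $m,m'$ such that $m\le m'$ and $m\to\infty$ $$\max\left\{\left\|\boldsymbol{\eta}_m-\boldsymbol{\eta}_{m'}^{(m)}\right\|_2,\ \left\|\boldsymbol{\mu}_m-\boldsymbol{\mu}_{m'}^{(m)}\right\|_2,\ \left\|\boldsymbol{\sigma}_{\mathbf{v},m}-\boldsymbol{\sigma}_{\mathbf{v},m'}^{(m)}\right\|_2\right\}\to 0\quad\text{a.s.},$$ then $$m^{-1}\left|R_m(t|\boldsymbol{\eta})-\mathbb{E}_{\mathbf{v}}[R_m(t|\boldsymbol{\eta})]\right|\to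 0\ \text{a.s.}\quad\text{and}\quad m^{-1}\left|V_m(t|\boldsymbol{\eta})-\mathbb{E}_{\mathbf{v}}[V_m(t|\boldsymbol{\eta})]\right|\to 0\ \text{a.s.}$$ If in addition $\liminf_{m\to\infty}\pi_{0,m}>0$ and $\lim_{m\to\infty}\min_{i\in Q_{0,m}}\tilde p_i>0$ a.s. uniformly in $\boldsymbol{\eta}$, then $$m^{-1}\left|\mathrm{FDP}_m(t|\boldsymbol{\eta})-\mathbb{E}_{\mathbf{v}}[\mathrm{FDP}_m(t|\boldsymbol{\eta})]\right|\to 0\ \text{a.s.}$$
   Context: All random vectors live on one probability space $(\Omega,\mathcal{F},\mathbb{P})$. $\mathsf{N}_m(\mathbf{a},\mathbf{C})$ is the Normal distribution with mean $\mathbf{a}$ and (possibly singular) covariance matrix $\mathbf{C}$; $\Phi$ is the CDF of $\mathsf{N}_1(0,1)$. For a matrix $\mathbf{A}$, $\|\mathbf{A}\|_1=\sum_{i,j}|\mathbf{A}(i,j)|$; $\|\cdot\|_2$ is the Euclidean norm on vectors. For $\mathbf{a}=(a_1,\ldots,a_{m'})$ and $m\le m'$, $\mathbf{a}^{(m)}=(a_1,\ldots,a_m)$. The subscript $m$ is dropped when convenient: $\boldsymbol{\mu}=\boldsymbol{\mu}_m$, $\boldsymbol{\eta}=\boldsymbol{\eta}_m$, $\mathbf{v}=\mathbf{v}_m$, with components $\mu_i,\eta_i,v_i$. All components of $\boldsymbol{\zeta}_m$ have nonzero variance. Correlations involving a component $v_i$ of zero variance are taken to be $0$. The adjusted conditional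 multiple testing procedure tests $H_{i0}:\mu_i=0$ versus $\mu_i\neq 0$ using, conditionally on $\boldsymbol{\eta}$, either one-sided p-values $\tilde p_i=1-\Phi(\sigma_{i,m}^{-1}(\zeta_i-\eta_i))$ or two-sided p-values $\tilde p_i=2\Phi(-\sigma_{i,m}^{-1}|\zeta_i-\eta_i|)$ (the result is asserted for both types), where $\zeta_i-\eta_i=\mu_i+v_i\sim\mathsf{N}_1(\mu_i,\sigma_{i,m}^2)$; it rejects $H_{i0}$ iff $\tilde p_i\le t$. More generally, $\tilde p_i=1-\tilde F_i(\zeta_i-\eta_i)$ or $2\tilde F_i(-|\zeta_i-\eta_i|)$ with $\tilde F_i$ the CDF of $\zeta_i-\eta_i$ when $\mu_i=0$. Set $X_i=1_{\{\tilde p_i\le t\}}$, $Q_{0,m}=\{1\le i\le m:\mu_i=0\}$, $\pi_{0,m}=|Q_{0,m}|/m$, $R_m(t|\boldsymbol{\eta})=\sum_{i=1}^m X_i$, $V_m(t|\boldsymbol{\eta})=\sum_{i\in Q_{0,m}}X_i$, $\mathrm{FDP}_m(t|\boldsymbol{\eta})=V_m(t|\boldsymbol{\eta})/(R_m(t|\boldsymbol{\eta})\vee 1)$. $\mathbb{E}_{\mathbf{v}}$ is expectation with respect to the distribution of $\mathbf{v}$. *)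

theory Defs
  imports "HOL-Probability.Probability" "HOL-Library.Landau_Symbols"
begin

text \<open>
  A vector in \<open>m\<close>-dimensional space is a function \<^typ>\<open>nat \<Rightarrow> real\<close> of which only the values at the
  indices \<open>{1..m}\<close> matter; a random vector is a family \<^typ>\<open>nat \<Rightarrow> 'a \<Rightarrow> real\<close> of random
  variables. In a triangular array the first argument is the dimension \<open>m\<close>.
\<close>

definition covariance :: "'a measure \<Rightarrow> ('a \<Rightarrow> real) \<Rightarrow> ('a \<Rightarrow> real) \<Rightarrow> real" where
  "covariance M X Y =
     prob_space.expectation M (\<lambda>\<omega>. (X \<omega> - prob_space.expectation M X) *
                                   (Y \<omega> - prob_space.expectation M Y))"

definition std_dev :: "'a measure \<Rightarrow> ('a \<Rightarrow> real) \<Rightarrow> real" where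
  "std_dev M X = sqrt (prob_space.variance M X)"

text \<open>Since \<open>x / 0 = 0\<close>, the correlation is \<open>0\<close> as soon as one of the variances is \<open>0\<close>.\<close>

definition correlation :: "'a measure \<Rightarrow> ('a \<Rightarrow> real) \<Rightarrow> ('a \<Rightarrow> real) \<Rightarrow> real" where
  "correlation M X Y = covariance M X Y / (std_dev M X * std_dev M Y)"

definition matrix_norm1 :: "nat \<Rightarrow> (nat \<Rightarrow> nat \<Rightarrow> real) \<Rightarrow> real" where
  "matrix_norm1 m A = (\<Sum>i=1..m. \<Sum>j=1..m. \<bar>A i j\<bar>)"

text \<open>The second parameter is the variance; variance \<open>0\<close> gives the point mass at the mean.\<close>

definition normal_law :: "real \<Rightarrow> real \<Rightarrow> real measure" where
  "normal_law a c =
     (if c = 0 then return borel a else density lborel (normal_density a (sqrt c)))"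

text \<open>
  The possibly singular normal distribution with mean vector \<open>a\<close> and covariance matrix \<open>C\<close>: \<open>C\<close> is
  symmetric and positive semidefinite, and every linear combination of the components is normal
  with the corresponding mean and variance.
\<close>

definition mv_normal ::
  "'a measure \<Rightarrow> nat \<Rightarrow> (nat \<Rightarrow> 'a \<Rightarrow> real) \<Rightarrow> (nat \<Rightarrow> real) \<Rightarrow> (nat \<Rightarrow> nat \<Rightarrow> real) \<Rightarrow> bool" where
  "mv_normal M m X a C \<longleftrightarrow>
     (\<forall>i\<in>{1..m}. X i \<in> borel_measurable M) \<and>
     (\<forall>i\<in>{1..m}. \<forall>j\<in>{1..m}. C i j = C j i) \<and>
     (\<forall>u. 0 \<le> (\<Sum>i=1..m. \<Sum>j=1..m. u i * C i j * u j) \<and>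
          distr M borel (\<lambda>\<omega>. \<Sum>i=1..m. u i * X i \<omega>) =
            normal_law (\<Sum>i=1..m. u i * a i) (\<Sum>i=1..m. \<Sum>j=1..m. u i * C i j * u j))"

definition Phi :: "real \<Rightarrow> real" where
  "Phi = cdf std_normal_distribution"

definition vec_space :: "nat \<Rightarrow> (nat \<Rightarrow> real) measure" where
  "vec_space m = PiM {1..m} (\<lambda>_. borel)"

definition rand_vec :: "nat \<Rightarrow> (nat \<Rightarrow> 'a \<Rightarrow> real) \<Rightarrow> 'a \<Rightarrow> nat \<Rightarrow> real" where
  "rand_vec m X \<omega> = (\<lambda>i\<in>{1..m}. X i \<omega>)"

definition expect_wrt ::
  "'a measure \<Rightarrow> nat \<Rightarrow> (nat \<Rightarrow> 'a \<Rightarrow> real) \<Rightarrow> ((nat \<Rightarrow> real) \<Rightarrow> real) \<Rightarrow> real" where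
  "expect_wrt M m X g = (\<integral>x. g x \<partial>(distr M (vec_space m) (rand_vec m X)))"

datatype sidedness = One_Sided | Two_Sided

text \<open>
  The distribution function of \<open>\<zeta>\<^sub>i - \<eta>\<^sub>i\<close> under \<open>\<mu>\<^sub>i = 0\<close> is that of \<open>v\<^sub>i\<close>. In this form the p-value is
  also defined if \<open>v\<^sub>i\<close> has variance \<open>0\<close>; if it does not, \<open>null_cdf_eq_Phi\<close> below gives the p-value in
  terms of \<^const>\<open>Phi\<close>.
\<close>

definition null_cdf :: "'a measure \<Rightarrow> (nat \<Rightarrow> 'a \<Rightarrow> real) \<Rightarrow> nat \<Rightarrow> real \<Rightarrow> real" where
  "null_cdf M v i = cdf (distr M borel (v i))"

text \<open>
  From here on \<open>F\<close> is the family of null distribution functions, \<open>z\<close> a value of \<open>\<zeta>\<close> and \<open>h\<close> a value of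
  \<open>\<eta>\<close>.
\<close>

definition adj_pval ::
  "sidedness \<Rightarrow> (nat \<Rightarrow> real \<Rightarrow> real) \<Rightarrow> (nat \<Rightarrow> real) \<Rightarrow> (nat \<Rightarrow> real) \<Rightarrow> nat \<Rightarrow> real" where
  "adj_pval s F z h i =
     (case s of One_Sided \<Rightarrow> 1 - F i (z i - h i)
              | Two_Sided \<Rightarrow> 2 * F i (- \<bar>z i - h i\<bar>))"

definition rejected ::
  "sidedness \<Rightarrow> (nat \<Rightarrow> real \<Rightarrow> real) \<Rightarrow> real \<Rightarrow> (nat \<Rightarrow> real) \<Rightarrow> (nat \<Rightarrow> real) \<Rightarrow> nat \<Rightarrow> real" where
  "rejected s F t z h i = (if adj_pval s F z h i \<le> t then 1 else 0)"

definition true_nulls :: "nat \<Rightarrow> (nat \<Rightarrow> real) \<Rightarrow> nat set" where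
  "true_nulls m \<mu> = {i \<in> {1..m}. \<mu> i = 0}"

definition null_prop :: "nat \<Rightarrow> (nat \<Rightarrow> real) \<Rightarrow> real" where
  "null_prop m \<mu> = real (card (true_nulls m \<mu>)) / real m"

definition num_rej ::
  "sidedness \<Rightarrow> (nat \<Rightarrow> real \<Rightarrow> real) \<Rightarrow> real \<Rightarrow> nat \<Rightarrow> (nat \<Rightarrow> real) \<Rightarrow> (nat \<Rightarrow> real) \<Rightarrow> real" where
  "num_rej s F t m z h = (\<Sum>i=1..m. rejected s F t z h i)"

definition num_false_rej ::
  "sidedness \<Rightarrow> (nat \<Rightarrow> real \<Rightarrow> real) \<Rightarrow> real \<Rightarrow> nat \<Rightarrow> (nat \<Rightarrow> real) \<Rightarrow> (nat \<Rightarrow> real) \<Rightarrow>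
     (nat \<Rightarrow> real) \<Rightarrow> real" where
  "num_false_rej s F t m \<mu> z h = (\<Sum>i\<in>true_nulls m \<mu>. rejected s F t z h i)"

definition FDP ::
  "sidedness \<Rightarrow> (nat \<Rightarrow> real \<Rightarrow> real) \<Rightarrow> real \<Rightarrow> nat \<Rightarrow> (nat \<Rightarrow> real) \<Rightarrow> (nat \<Rightarrow> real) \<Rightarrow>
     (nat \<Rightarrow> real) \<Rightarrow> real" where
  "FDP s F t m \<mu> z h = num_false_rej s F t m \<mu> z h / max (num_rej s F t m z h) 1"

definition ordered_pairs_at_top :: "(nat \<times> nat) filter" where
  "ordered_pairs_at_top = inf (filtercomap fst sequentially) (principal {(m, m'). m \<le> m'})"

lemma eventually_ordered_pairs_at_top:
  "eventually P ordered_pairs_at_top \<longleftrightarrow> (\<exists>N. \<forall>m m'. N \<le> m \<longrightarrow> m \<le> m' \<longrightarrow> P (m, m'))"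
  unfolding ordered_pairs_at_top_def eventually_inf_principal eventually_filtercomap
    eventually_sequentially
  by (auto; blast)

lemma mv_normal_component:
  assumes "mv_normal M m X a C" "i \<in> {1..m}"
  shows "distr M borel (X i) = normal_law (a i) (C i i)" "0 \<le> C i i"
proof -
  define u :: "nat \<Rightarrow> real" where "u = (\<lambda>j. if j = i then 1 else 0)"
  have l: "(\<Sum>j=1..m. u j * f j) = f i" for f :: "nat \<Rightarrow> real"
    using assms(2) by (simp add: u_def if_distrib[of "\<lambda>x. x * _"] cong: if_cong)
  have q: "(\<Sum>k=1..m. \<Sum>j=1..m. u k * C k j * u j) = C i i"
    using l[of "\<lambda>k. \<Sum>j=1..m. C k j * u j"] l[of "C i"]
    by (simp add: sum_distrib_left mult.assoc mult.commute[of "u _" "C i _"])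
  from assms(1) have "0 \<le> (\<Sum>k=1..m. \<Sum>j=1..m. u k * C k j * u j) \<and>
          distr M borel (\<lambda>\<omega>. \<Sum>j=1..m. u j * X j \<omega>) =
            normal_law (\<Sum>j=1..m. u j * a j) (\<Sum>k=1..m. \<Sum>j=1..m. u k * C k j * u j)"
    unfolding mv_normal_def by blast
  then show "distr M borel (X i) = normal_law (a i) (C i i)" "0 \<le> C i i"
    unfolding q l by auto
qed

lemma null_cdf_eq_Phi:
  assumes M: "prob_space M" and X: "mv_normal M m X (\<lambda>_. 0) C" and i: "i \<in> {1..m}"
    and nz: "std_dev M (X i) \<noteq> 0"
  shows "null_cdf M X i x = Phi (inverse (std_dev M (X i)) * x)"
proof -
  interpret prob_space M by fact
  have lb: "distr M lborel f = distr M borel f" for f :: "'a \<Rightarrow> real"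
    by (rule distr_cong) auto
  note mv_normal_component[OF X i]
  moreover have [measurable]: "X i \<in> borel_measurable M"
    using X i by (auto simp: mv_normal_def)
  have "C i i \<noteq> 0"
  proof
    assume "C i i = 0"
    then have d: "distr M borel (X i) = return borel 0"
      using mv_normal_component(1)[OF X i] by (simp add: normal_law_def)
    have "expectation (\<lambda>\<omega>. (X i \<omega> - c)\<^sup>2) = (\<integral>y. (y - c)\<^sup>2 \<partial>distr M borel (X i))" for c
      by (subst integral_distr) auto
    from this[of 0] have "expectation (\<lambda>\<omega>. (X i \<omega>)\<^sup>2) = 0"
      unfolding d by (simp add: integral_return)
    moreover have "expectation (X i) = (\<integral>y. y \<partial>distr M borel (X i))"
      by (subst integral_distr) auto
    then have "expectation (X i) = 0"
      unfolding d by (simp add: integral_return)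
    ultimately show False using nz by (simp add: std_dev_def)
  qed
  ultimately have c: "0 < C i i"
    and D: "distributed M lborel (X i) (normal_density 0 (sqrt (C i i)))"
    by (auto simp: normal_law_def distributed_def lb)
  define \<sigma> where "\<sigma> = sqrt (C i i)"
  have \<sigma>: "0 < \<sigma>" using c by (simp add: \<sigma>_def)
  have sd: "std_dev M (X i) = \<sigma>"
    using normal_distributed_variance[OF _ D] c unfolding std_dev_def \<sigma>_def by simp
  have Z: "distributed M lborel (\<lambda>\<omega>. (X i \<omega> - 0) / \<sigma>) std_normal_density"
    using D normal_standard_normal_convert[OF \<sigma>, of "X i" 0] by (simp add: \<sigma>_def)
  have Z': "distr M borel (\<lambda>\<omega>. X i \<omega> / \<sigma>) = std_normal_distribution"
    using Z by (simp add: distributed_def lb)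
  have "null_cdf M X i x = prob {\<omega> \<in> space M. X i \<omega> \<le> x}"
    unfolding null_cdf_def cdf_def
    by (subst measure_distr) (auto intro!: arg_cong[where f = prob])
  also have "{\<omega> \<in> space M. X i \<omega> \<le> x} = {\<omega> \<in> space M. X i \<omega> / \<sigma> \<le> x / \<sigma>}"
    using \<sigma> by (auto simp: field_simps)
  also have "prob \<dots> = cdf (distr M borel (\<lambda>\<omega>. X i \<omega> / \<sigma>)) (x / \<sigma>)"
    unfolding cdf_def
    by (subst measure_distr) (auto intro!: arg_cong[where f = prob])
  also have "\<dots> = Phi (x / \<sigma>)"
    unfolding Z' Phi_def ..
  finally show ?thesis by (simp add: sd field_simps)
qed

end

theory Submission
  imports Defs
begin

text \<open>
  Since \<open>\<zeta> - \<eta> = \<mu> + v\<close>, the variables \<open>\<eta>\<close> drop out of the p-values: the number of rejections is a sum of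
  indicators \<open>v\<^sub>i \<in> A\<^sub>i\<close>, where each \<open>A\<^sub>i\<close> is a half-line or the union of two half-lines, and
  \<open>E\<^sub>v\<close> of it is a constant. Nothing relates the vectors \<open>v\<close> of different dimensions, so a variance bound
  along a subsequence does not suffice; instead the deviation probabilities are shown to be summable
  over all dimensions. The indicators of half-lines are sandwiched between smooth steps of width
  \<open>\<epsilon>\<close>, at the price of an error \<open>2\<epsilon>\<close> in the mean. For an average \<open>F\<close> of smooth functions of the
  standardized components the Maurey-Pisier argument applies: with an independent copy \<open>v'\<close> and
  \<open>v\<^sub>\<theta> = v sin \<theta> + v' cos \<theta>\<close>, the difference \<open>F(v) - F(v')\<close> is the integral over \<open>\<theta>\<close> of the gradient at
  \<open>v\<^sub>\<theta>\<close> applied to the derivative of \<open>v\<^sub>\<theta>\<close>, the joint law of \<open>v\<^sub>\<theta>\<close> and its derivative is that of \<open>(v, v')\<close>,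
  and so, given \<open>v\<^sub>\<theta>\<close>, the integrand is normal with variance at most \<open>L\<^sup>2 \<parallel>R\<parallel>\<^sub>1 / m\<^sup>2\<close>. This gives tails
  \<open>2 exp(- b m powr \<delta>)\<close>, and the Borel-Cantelli lemma finishes the proof. The false discovery
  proportion lies in \<open>[0, 1]\<close>, hence its deviation divided by \<open>m\<close> tends to \<open>0\<close> trivially.
\<close>

subsection \<open>Uniqueness of the law of a random vector\<close>

text \<open>Taking \<open>t = 0\<close> in the hypothesis shows that both weights have the same
  total mass \<open>c\<close>. Divided by \<open>c\<close> they are probability densities, and Levy
  uniqueness applies to the laws of \<open>X\<close> and \<open>Y\<close> under them.\<close>

lemma Levy_uniqueness_weighted:
  fixes X Z :: "'a \<Rightarrow> real" and Y W :: "'b \<Rightarrow> real"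
  assumes M: "prob_space M" and N: "prob_space N"
    and [measurable]: "X \<in> borel_measurable M" "Z \<in> borel_measurable M"
      "Y \<in> borel_measurable N" "W \<in> borel_measurable N"
    and Z: "\<And>x. 0 \<le> Z x" "\<And>x. Z x \<le> K" and W: "\<And>x. 0 \<le> W x" "\<And>x. W x \<le> K"
    and char_eq: "\<And>t. (\<integral>x. of_real (Z x) * iexp (t * X x) \<partial>M) = (\<integral>x. of_real (W x) * iexp (t * Y x) \<partial>N)"
    and [measurable]: "B \<in> sets borel"
  shows "(\<integral>x. Z x * indicator B (X x) \<partial>M) = (\<integral>x. W x * indicator B (Y x) \<partial>N)"
proof -
  interpret M: prob_space M by fact
  interpret N: prob_space N by fact
  have intZ: "integrable M Z" by (rule M.integrable_const_bound[of _ K]) (use Z in auto)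
  have intW: "integrable N W" by (rule N.integrable_const_bound[of _ K]) (use W in auto)
  define c where "c = (\<integral>x. Z x \<partial>M)"
  have cW: "c = (\<integral>x. W x \<partial>N)"
    using char_eq[of 0] by (simp add: c_def)
  have c0: "c \<ge> 0" using Z by (simp add: c_def)
  show ?thesis
  proof (cases "c = 0")
    case True
    \<comment> \<open>Weights of total mass 0 cannot be normalized, but being nonnegative they
      vanish almost everywhere.\<close>
    have 1: "AE x in M. Z x = 0"
      using True Z intZ by (subst (asm) c_def, subst (asm) integral_nonneg_eq_0_iff_AE) auto
    have 2: "AE x in N. W x = 0"
      using True[unfolded cW] W intW by (subst (asm) integral_nonneg_eq_0_iff_AE) auto
    have "(\<integral>x. Z x * indicator B (X x) \<partial>M) = (\<integral>x. 0 \<partial>M)"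
      by (rule integral_cong_AE) (use 1 in auto)
    moreover have "(\<integral>x. W x * indicator B (Y x) \<partial>N) = (\<integral>x. 0 \<partial>N)"
      by (rule integral_cong_AE) (use 2 in auto)
    ultimately show ?thesis by simp
  next
    case False
    with c0 have c: "c > 0" by simp
    have dens: "prob_space (density Q (\<lambda>x. ennreal (V x / c)))"
      if "prob_space Q" "integrable Q V" "\<And>x. 0 \<le> V x" "c = (\<integral>x. V x \<partial>Q)" for Q :: "'c measure" and V
    proof (rule prob_spaceI)
      have [measurable]: "V \<in> borel_measurable Q" using that by auto
      have "emeasure (density Q (\<lambda>x. ennreal (V x / c))) (space Q) = (\<integral>\<^sup>+x. ennreal (V x / c) \<partial>Q)"
        by (subst emeasure_density) (auto intro!: nn_integral_cong)
      also have "\<dots> = ennreal (\<integral>x. V x / c \<partial>Q)"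
        by (rule nn_integral_eq_integral) (use that c in auto)
      also have "\<dots> = 1" using that c by simp
      finally show "emeasure (density Q (\<lambda>x. ennreal (V x / c))) (space (density Q (\<lambda>x. ennreal (V x / c)))) = 1"
        by simp
    qed
    define P where "P = distr (density M (\<lambda>x. ennreal (Z x / c))) borel X"
    define Q where "Q = distr (density N (\<lambda>x. ennreal (W x / c))) borel Y"
    interpret P: real_distribution P
      unfolding P_def real_distribution_def real_distribution_axioms_def
      using dens[OF M intZ Z(1) c_def] by (auto intro!: prob_space.prob_space_distr)
    interpret Q: real_distribution Q
      unfolding Q_def real_distribution_def real_distribution_axioms_def
      using dens[OF N intW W(1) cW] by (auto intro!: prob_space.prob_space_distr)
    have "char P t = char Q t" for t
    proof -
      have "char P t = (\<integral>x. (Z x / c) *\<^sub>R iexp (t * X x) \<partial>M)"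
        unfolding char_def P_def using Z c
        by (subst integral_distr, simp, simp, subst integral_density) auto
      also have "\<dots> = (\<integral>x. of_real (Z x) * iexp (t * X x) \<partial>M) / c"
        by (simp add: scaleR_conv_of_real)
      also have "\<dots> = (\<integral>x. (W x / c) *\<^sub>R iexp (t * Y x) \<partial>N)"
        using char_eq[of t] by (simp add: scaleR_conv_of_real)
      also have "\<dots> = char Q t"
        unfolding char_def Q_def using W c
        by (subst integral_distr, simp, simp, subst integral_density) auto
      finally show ?thesis .
    qed
    then have "P = Q"
      by (intro Levy_uniqueness P.real_distribution_axioms Q.real_distribution_axioms) auto
    moreover have "(\<integral>x. Z x * indicator B (X x) \<partial>M) = c * (\<integral>x. indicator B x \<partial>P)"
      unfolding P_def using Z c
      by (subst integral_distr, simp, simp, subst integral_density) auto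
    moreover have "(\<integral>x. W x * indicator B (Y x) \<partial>N) = c * (\<integral>x. indicator B x \<partial>Q)"
      unfolding Q_def using W c
      by (subst integral_distr, simp, simp, subst integral_density) auto
    ultimately show ?thesis by simp
  qed
qed

text \<open>
  The characters are replaced by indicators one coordinate at a time. The weights \<open>1 + cos\<close> stand for
  the remaining characters because Levy uniqueness needs nonnegative weights.
\<close>

lemma prod_indicator_char_eq:
  fixes X :: "'i \<Rightarrow> 'a \<Rightarrow> real" and Y :: "'i \<Rightarrow> 'b \<Rightarrow> real"
  assumes M: "prob_space M" and N: "prob_space N" and I: "finite I"
    and X[measurable]: "\<And>i. i \<in> I \<Longrightarrow> X i \<in> borel_measurable M"
    and Y[measurable]: "\<And>i. i \<in> I \<Longrightarrow> Y i \<in> borel_measurable N"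
    and char_eq: "\<And>u. (\<integral>x. iexp (\<Sum>i\<in>I. u i * X i x) \<partial>M) = (\<integral>x. iexp (\<Sum>i\<in>I. u i * Y i x) \<partial>N)"
    and K: "K \<subseteq> I"
  shows "(\<And>i. i \<in> K \<Longrightarrow> A i \<in> sets borel) \<Longrightarrow>
    (\<integral>x. of_real (\<Prod>i\<in>K. indicator (A i) (X i x)) * iexp (\<Sum>i\<in>I. u i * X i x) \<partial>M) =
    (\<integral>x. of_real (\<Prod>i\<in>K. indicator (A i) (Y i x)) * iexp (\<Sum>i\<in>I. u i * Y i x) \<partial>N)"
  using finite_subset[OF K I] K
\<comment> \<open>The frequency vector stays arbitrary because the step applies the induction
  hypothesis to shifts of \<open>u\<close> and \<open>- u\<close> along coordinate
  \<open>j\<close>.\<close>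
proof (induction K arbitrary: u rule: finite_induct)
  case empty
  then show ?case using char_eq by simp
next
  case (insert j K)
  interpret M: prob_space M by fact
  interpret N: prob_space N by fact
  have KI: "K \<subseteq> I" and j: "j \<in> I" using insert by auto
  have [measurable]: "A i \<in> sets borel" if "i \<in> insert j K" for i
    using insert that by auto
  define p where "p = (\<lambda>(X :: 'i \<Rightarrow> real). \<Prod>i\<in>K. indicator (A i) (X i) :: real)"
  define s where "s = (\<lambda>(u :: 'i \<Rightarrow> real) (X :: 'i \<Rightarrow> real). \<Sum>i\<in>I. u i * X i)"
  have [measurable]: "X i \<in> borel_measurable M" "Y i \<in> borel_measurable N" if "i \<in> K" for i
    using KI that X Y by auto
  have [measurable]: "X j \<in> borel_measurable M" "Y j \<in> borel_measurable N" "A j \<in> sets borel"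
    using j X Y insert by auto
  have [measurable]: "(\<lambda>x. p (\<lambda>i. X i x)) \<in> borel_measurable M"
    "(\<lambda>x. p (\<lambda>i. Y i x)) \<in> borel_measurable N"
    unfolding p_def by measurable
  have [measurable]: "(\<lambda>x. s u (\<lambda>i. X i x)) \<in> borel_measurable M"
    "(\<lambda>x. s u (\<lambda>i. Y i x)) \<in> borel_measurable N" for u
    unfolding s_def by measurable
  have p: "0 \<le> p x" "p x \<le> 1" for x
    unfolding p_def by (auto intro!: prod_nonneg prod_le_1 simp: indicator_def)
  have IH: "(\<integral>x. of_real (p (\<lambda>i. X i x)) * iexp (s u (\<lambda>i. X i x)) \<partial>M) =
      (\<integral>x. of_real (p (\<lambda>i. Y i x)) * iexp (s u (\<lambda>i. Y i x)) \<partial>N)" for u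
    using insert.IH[of u] insert.prems KI by (auto simp: p_def s_def)
  have intM: "integrable M (\<lambda>x. of_real (p (\<lambda>i. X i x)) * iexp (s u (\<lambda>i. X i x)))" for u
    by (rule M.integrable_const_bound[of _ 1]) (use p in \<open>auto simp: norm_mult simp del: of_real_mult\<close>)
  have intN: "integrable N (\<lambda>x. of_real (p (\<lambda>i. Y i x)) * iexp (s u (\<lambda>i. Y i x)))" for u
    by (rule N.integrable_const_bound[of _ 1]) (use p in \<open>auto simp: norm_mult simp del: of_real_mult\<close>)
  \<comment> \<open>The unit vector of coordinate \<open>j\<close>: adding \<open>t * e\<close> to
    the frequencies contributes the factor \<open>iexp (t * x j)\<close>.\<close>
  define e where "e = (\<lambda>i. if i = j then 1 else 0 :: real)"
  have s_e: "s (\<lambda>i. t * e i) x = t * x j" for t x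
    using j I by (simp add: s_def e_def if_distrib[of "\<lambda>y. y * _"] if_distrib[of "\<lambda>y. _ * y"] cong: if_cong)
  have s_add: "s (\<lambda>i. a i + b i) x = s a x + s b x" for a b x
    by (simp add: s_def sum.distrib algebra_simps)
  have s_minus: "s (\<lambda>i. - a i) x = - s a x" for a x
    by (simp add: s_def sum_negf)
  have s_0: "s (\<lambda>i. 0) x = 0" for x
    by (simp add: s_def)
  \<comment> \<open>Writing the cosine as half the sum of two exponentials turns the weighted
    character into three characters with weight \<open>p\<close>, whose integrals agree by
    induction.\<close>
  have expand: "of_real (p x * (1 + cos (s u x + \<phi>))) * iexp (t * x j) =
      of_real (p x) * iexp (s (\<lambda>i. t * e i) x)
      + (iexp \<phi> / 2) * (of_real (p x) * iexp (s (\<lambda>i. u i + t * e i) x))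
      + (iexp (-\<phi>) / 2) * (of_real (p x) * iexp (s (\<lambda>i. - u i + t * e i) x))" for x u \<phi> t
  proof -
    have c: "complex_of_real (cos y) = (iexp y + iexp (- y)) / 2" for y
      using cos_exp_eq[of "complex_of_real y"] by (simp add: cos_of_real)
    define E where "E y = iexp y" for y
    have E: "E (a + b) = E a * E b" for a b
      by (simp add: E_def exp_add distrib_left)
    have "of_real (p x * (1 + cos (s u x + \<phi>))) = of_real (p x) * (1 + (E (s u x + \<phi>) + E (- s u x + - \<phi>)) / 2)"
      unfolding of_real_mult of_real_add c by (simp add: E_def algebra_simps)
    then have *: "of_real (p x * (1 + cos (s u x + \<phi>))) = of_real (p x) * (1 + (E (s u x) * E \<phi> + E (- s u x) * E (- \<phi>)) / 2)"
      unfolding E .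
    show ?thesis
      unfolding s_add s_e s_minus E_def[symmetric] E * by (simp add: algebra_simps)
  qed
  have weighted: "(\<integral>x. (p (\<lambda>i. X i x) * (1 + cos (s u (\<lambda>i. X i x) + \<phi>))) * indicator (A j) (X j x) \<partial>M) =
      (\<integral>x. (p (\<lambda>i. Y i x) * (1 + cos (s u (\<lambda>i. Y i x) + \<phi>))) * indicator (A j) (Y j x) \<partial>N)" for u \<phi>
  proof (rule Levy_uniqueness_weighted[OF M N, where K = 2])
    have b: "0 \<le> 1 + cos y" "1 + cos y \<le> 2" for y :: real
      using cos_ge_minus_one[of y] cos_le_one[of y] by linarith+
    show "0 \<le> p x * (1 + cos (s u x + \<phi>))" "p x * (1 + cos (s u x + \<phi>)) \<le> 2" for x
      using mult_mono[OF p(2) b(2), of "s u x + \<phi>" x] p b by auto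
    then show "0 \<le> p (\<lambda>i. Y i x) * (1 + cos (s u (\<lambda>i. Y i x) + \<phi>))"
      "p (\<lambda>i. Y i x) * (1 + cos (s u (\<lambda>i. Y i x) + \<phi>)) \<le> 2" for x .
    show "(\<integral>x. of_real (p (\<lambda>i. X i x) * (1 + cos (s u (\<lambda>i. X i x) + \<phi>))) * iexp (t * X j x) \<partial>M) =
      (\<integral>x. of_real (p (\<lambda>i. Y i x) * (1 + cos (s u (\<lambda>i. Y i x) + \<phi>))) * iexp (t * Y j x) \<partial>N)" for t
      using expand[of "\<lambda>i. X i x" for x] expand[of "\<lambda>i. Y i x" for x]
      by (simp only: Bochner_Integration.integral_add Bochner_Integration.integrable_add Bochner_Integration.integrable_mult_right
          Bochner_Integration.integral_mult_right intM intN IH)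
  qed measurable
  have intM': "integrable M (\<lambda>x. p (\<lambda>i. X i x) * indicator (A j) (X j x) * cos (s u (\<lambda>i. X i x) + \<phi>))" for u \<phi>
    by (rule M.integrable_const_bound[of _ 1])
      (use p in \<open>auto simp: abs_mult indicator_def intro!: mult_le_one\<close>)
  have intN': "integrable N (\<lambda>x. p (\<lambda>i. Y i x) * indicator (A j) (Y j x) * cos (s u (\<lambda>i. Y i x) + \<phi>))" for u \<phi>
    by (rule N.integrable_const_bound[of _ 1])
      (use p in \<open>auto simp: abs_mult indicator_def intro!: mult_le_one\<close>)
  have cos_eq: "(\<integral>x. p (\<lambda>i. X i x) * indicator (A j) (X j x) * cos (s u (\<lambda>i. X i x) + \<phi>) \<partial>M) =
    (\<integral>x. p (\<lambda>i. Y i x) * indicator (A j) (Y j x) * cos (s u (\<lambda>i. Y i x) + \<phi>) \<partial>N)" for u \<phi>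
  proof -
    \<comment> \<open>With zero frequency and phase the weight is \<open>2 * p\<close>. This
      isolates the contribution of the constant 1, which is then subtracted to leave the cosine
      alone.\<close>
    have 1: "(\<integral>x. p (\<lambda>i. X i x) * indicator (A j) (X j x) \<partial>M) = (\<integral>x. p (\<lambda>i. Y i x) * indicator (A j) (Y j x) \<partial>N)"
    proof -
      have "p x * (1 + cos (s (\<lambda>_. 0) x + 0)) * y = 2 * (p x * y)" for x y
        by (simp add: s_0)
      then show ?thesis
        using weighted[of "\<lambda>_. 0" 0] by (simp only: integral_mult_right_zero)
    qed
    have iM: "integrable M (\<lambda>x. p (\<lambda>i. X i x) * indicator (A j) (X j x))"
      using intM'[of "\<lambda>_. 0" 0] by (simp add: s_0)
    have iN: "integrable N (\<lambda>x. p (\<lambda>i. Y i x) * indicator (A j) (Y j x))"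
      using intN'[of "\<lambda>_. 0" 0] by (simp add: s_0)
    have d: "p x * (1 + cos (s u x + \<phi>)) * indicator (A j) (x j) =
       p x * indicator (A j) (x j) + p x * indicator (A j) (x j) * cos (s u x + \<phi>)" for x
      by (simp add: algebra_simps)
    show ?thesis
      using weighted[of u \<phi>] 1 d[of "\<lambda>i. X i x" for x] d[of "\<lambda>i. Y i x" for x]
      by (simp only: Bochner_Integration.integral_add iM iN intM' intN')
  qed
  have prod_insert: "(\<Prod>i\<in>insert j K. indicator (A i) (x i) :: real) = p x * indicator (A j) (x j)" for x
    using insert.hyps by (simp add: p_def)
  \<comment> \<open>Phase 0 gives the real part of the character; phase \<open>- pi / 2\<close>
    turns the cosine into a sine and gives the imaginary part.\<close>
  have split: "of_real (p x * indicator (A j) (x j)) * iexp (s u x) =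
     of_real (p x * indicator (A j) (x j) * cos (s u x + 0))
     + \<i> * of_real (p x * indicator (A j) (x j) * cos (s u x + - (pi / 2)))" for x
    by (simp add: cis_conv_exp[symmetric] cis.ctr complex_eq_iff cos_diff)
  have "(\<integral>x. of_real (p (\<lambda>i. X i x) * indicator (A j) (X j x)) * iexp (s u (\<lambda>i. X i x)) \<partial>M) =
    (\<integral>x. of_real (p (\<lambda>i. Y i x) * indicator (A j) (Y j x)) * iexp (s u (\<lambda>i. Y i x)) \<partial>N)"
    using split[of "\<lambda>i. X i x" for x] split[of "\<lambda>i. Y i x" for x]
    by (simp only: Bochner_Integration.integral_add integrable_of_real Bochner_Integration.integrable_mult_right
        Bochner_Integration.integral_mult_right integral_of_real intM' intN' cos_eq)
  then show ?case
    unfolding prod_insert s_def .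
qed

text \<open>With every coordinate replaced by an indicator and zero frequencies,
  \<open>prod_indicator_char_eq\<close> says that the two laws agree on boxes, and boxes determine a
  finite measure on the product space.\<close>

lemma distr_PiM_eq_of_char_eq:
  fixes X :: "'i \<Rightarrow> 'a \<Rightarrow> real" and Y :: "'i \<Rightarrow> 'b \<Rightarrow> real"
  assumes M: "prob_space M" and N: "prob_space N" and I: "finite I"
    and X[measurable]: "\<And>i. i \<in> I \<Longrightarrow> X i \<in> borel_measurable M"
    and Y[measurable]: "\<And>i. i \<in> I \<Longrightarrow> Y i \<in> borel_measurable N"
    and char_eq: "\<And>u. (\<integral>x. iexp (\<Sum>i\<in>I. u i * X i x) \<partial>M) = (\<integral>x. iexp (\<Sum>i\<in>I. u i * Y i x) \<partial>N)"
  shows "distr M (\<Pi>\<^sub>M i\<in>I. borel) (\<lambda>x. \<lambda>i\<in>I. X i x) = distr N (\<Pi>\<^sub>M i\<in>I. borel) (\<lambda>x. \<lambda>i\<in>I. Y i x)"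
proof -
  interpret M: prob_space M by fact
  interpret N: prob_space N by fact
  have emeasure_box: "emeasure (distr Q (\<Pi>\<^sub>M i\<in>I. borel) (\<lambda>x. \<lambda>i\<in>I. Z i x)) (Pi\<^sub>E I A) =
      ennreal (\<integral>x. (\<Prod>i\<in>I. indicator (A i) (Z i x)) \<partial>Q)"
    if Q: "prob_space Q" and Z[measurable]: "\<And>i. i \<in> I \<Longrightarrow> Z i \<in> borel_measurable Q"
      and A: "\<And>i. i \<in> I \<Longrightarrow> A i \<in> sets borel" for Q :: "'c measure" and Z A
  proof -
    interpret Q: prob_space Q by fact
    have [measurable]: "Pi\<^sub>E I A \<in> sets (\<Pi>\<^sub>M i\<in>I. borel)"
      using A I by (auto intro!: sets_PiM_I_finite)
    have "emeasure (distr Q (\<Pi>\<^sub>M i\<in>I. borel) (\<lambda>x. \<lambda>i\<in>I. Z i x)) (Pi\<^sub>E I A) =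
        emeasure Q ((\<lambda>x. \<lambda>i\<in>I. Z i x) -` Pi\<^sub>E I A \<inter> space Q)"
      by (rule emeasure_distr) measurable
    also have "\<dots> = ennreal (\<integral>x. indicator ((\<lambda>x. \<lambda>i\<in>I. Z i x) -` Pi\<^sub>E I A \<inter> space Q) x \<partial>Q)"
      by (simp add: Q.emeasure_eq_measure)
    also have "(\<integral>x. indicator ((\<lambda>x. \<lambda>i\<in>I. Z i x) -` Pi\<^sub>E I A \<inter> space Q) x \<partial>Q) =
        (\<integral>x. (\<Prod>i\<in>I. indicator (A i) (Z i x) :: real) \<partial>Q)"
      using I by (intro Bochner_Integration.integral_cong refl)
        (auto simp: indicator_def PiE_iff prod.neutral split: if_splits)
    finally show ?thesis .
  qed
  show ?thesis
  proof (rule measure_eqI_PiM_finite[OF I, where M = "\<lambda>_. borel" and A = "\<lambda>_. \<Pi>\<^sub>E i\<in>I. UNIV"])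
    fix A :: "'i \<Rightarrow> real set" assume A: "\<And>i. i \<in> I \<Longrightarrow> A i \<in> sets borel"
    have "(\<integral>x. complex_of_real (\<Prod>i\<in>I. indicator (A i) (X i x)) \<partial>M) =
        (\<integral>x. complex_of_real (\<Prod>i\<in>I. indicator (A i) (Y i x)) \<partial>N)"
      using prod_indicator_char_eq[OF M N I X Y char_eq subset_refl A, where u = "\<lambda>_. 0"] by simp
    then have "(\<integral>x. (\<Prod>i\<in>I. indicator (A i) (X i x) :: real) \<partial>M) = (\<integral>x. (\<Prod>i\<in>I. indicator (A i) (Y i x)) \<partial>N)"
      unfolding integral_complex_of_real of_real_eq_iff .
    then show "emeasure (distr M (\<Pi>\<^sub>M i\<in>I. borel) (\<lambda>x. \<lambda>i\<in>I. X i x)) (Pi\<^sub>E I A) =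
        emeasure (distr N (\<Pi>\<^sub>M i\<in>I. borel) (\<lambda>x. \<lambda>i\<in>I. Y i x)) (Pi\<^sub>E I A)"
      using emeasure_box[OF M X A] emeasure_box[OF N Y A] by simp
  next
    show "range (\<lambda>_::nat. \<Pi>\<^sub>E i\<in>I. UNIV) \<subseteq> prod_algebra I (\<lambda>_. borel :: real measure)"
      using I by (auto intro!: prod_algebraI_finite)
    show "(\<Union>i::nat. (\<Pi>\<^sub>E i\<in>I. UNIV)) = space (\<Pi>\<^sub>M i\<in>I. (borel :: real measure))"
      by (simp add: space_PiM)
    have "emeasure (distr M (\<Pi>\<^sub>M i\<in>I. borel) (\<lambda>x. \<lambda>i\<in>I. X i x)) (\<Pi>\<^sub>E i\<in>I. UNIV) \<noteq> top"
      by (subst emeasure_box[OF M X]) auto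
    then show "emeasure (distr M (\<Pi>\<^sub>M i\<in>I. borel) (\<lambda>x. \<lambda>i\<in>I. X i x)) (\<Pi>\<^sub>E i\<in>I. UNIV) \<noteq> \<infinity>" for i :: nat
      by simp
  qed auto
qed

subsection \<open>Gaussian families\<close>

text \<open>Scaling a standard normal variable treats the point mass and the law with a density
  alike, so later arguments need no case distinction on the variance.\<close>

lemma normal_law_eq_distr:
  assumes "0 \<le> c"
  shows "normal_law 0 c = distr std_normal_distribution borel (\<lambda>x. sqrt c * x)"
proof (cases "c = 0")
  case True
  interpret prob_space std_normal_distribution
    by (rule prob_space_normal_density) simp
  show ?thesis using True by (simp add: normal_law_def distr_const)
next
  case False
  interpret prob_space std_normal_distribution
    by (rule prob_space_normal_density) simp
  have lb: "distr M lborel f = distr M borel f" for M and f :: "real \<Rightarrow> real"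
    by (rule distr_cong) auto
  have "distributed std_normal_distribution lborel (\<lambda>x. x) std_normal_density"
    by (simp add: distributed_def distr_id2)
  from normal_density_affine[OF this, of "sqrt c" 0] False assms show ?thesis
    by (simp add: distributed_def normal_law_def lb)
qed

text \<open>Completing the square: the exponential factor shifts the mean of the normal density from
  0 to \<open>s\<close>.\<close>

lemma nn_integral_exp_std_normal:
  "(\<integral>\<^sup>+x. ennreal (exp (s * x)) \<partial>std_normal_distribution) = ennreal (exp (s\<^sup>2 / 2))"
proof -
  interpret prob_space "density lborel (normal_density s 1)"
    by (rule prob_space_normal_density) simp
  have eq: "std_normal_density x * exp (s * x) = exp (s\<^sup>2 / 2) * normal_density s 1 x" for x
    by (simp add: normal_density_def exp_add[symmetric] power2_eq_square field_simps)
  have "(\<integral>\<^sup>+x. ennreal (exp (s * x)) \<partial>std_normal_distribution) =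
      (\<integral>\<^sup>+x. ennreal (exp (s\<^sup>2 / 2)) * ennreal (normal_density s 1 x) \<partial>lborel)"
    by (subst nn_integral_density)
      (auto simp: ennreal_mult[symmetric] eq)
  also have "\<dots> = ennreal (exp (s\<^sup>2 / 2)) * (\<integral>\<^sup>+x. ennreal (normal_density s 1 x) \<partial>lborel)"
    by (rule nn_integral_cmult) auto
  also have "(\<integral>\<^sup>+x. ennreal (normal_density s 1 x) \<partial>lborel) = 1"
    using emeasure_space_1 by (simp add: emeasure_density)
  finally show ?thesis by simp
qed

definition quad_form :: "'i set \<Rightarrow> ('i \<Rightarrow> 'i \<Rightarrow> real) \<Rightarrow> ('i \<Rightarrow> real) \<Rightarrow> real" where
  "quad_form I C u = (\<Sum>i\<in>I. \<Sum>j\<in>I. u i * C i j * u j)"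

text \<open>The centred case of \<open>mv_normal\<close> over an arbitrary index set: discarding the
  components of zero variance leaves indices that need not form an interval.\<close>

definition gaussian_family ::
  "'a measure \<Rightarrow> 'i set \<Rightarrow> ('i \<Rightarrow> 'a \<Rightarrow> real) \<Rightarrow> ('i \<Rightarrow> 'i \<Rightarrow> real) \<Rightarrow> bool" where
  "gaussian_family M I X C \<longleftrightarrow>
     (\<forall>i\<in>I. X i \<in> borel_measurable M) \<and>
     (\<forall>u. 0 \<le> quad_form I C u \<and>
       distr M borel (\<lambda>\<omega>. \<Sum>i\<in>I. u i * X i \<omega>) = normal_law 0 (quad_form I C u))"

text \<open>The map taking \<open>(p, q)\<close> to the two arguments is orthogonal: the mixed terms
  cancel entry by entry, and the others carry the factor
  \<open>a\<^sup>2 + b\<^sup>2\<close>.\<close>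

lemma quad_form_rotate:
  assumes "a\<^sup>2 + b\<^sup>2 = 1"
  shows "quad_form I C (\<lambda>i. a * p i + b * q i) + quad_form I C (\<lambda>i. b * p i - a * q i) =
    quad_form I C p + quad_form I C q"
proof -
  have "(a * p i + b * q i) * C i j * (a * p j + b * q j) + (b * p i - a * q i) * C i j * (b * p j - a * q j)
    = p i * C i j * p j + q i * C i j * q j" for i j
  proof -
    have "(a * p i + b * q i) * C i j * (a * p j + b * q j) + (b * p i - a * q i) * C i j * (b * p j - a * q j)
      = (a\<^sup>2 + b\<^sup>2) * (p i * C i j * p j + q i * C i j * q j)"
      by (simp add: power2_eq_square algebra_simps)
    then show ?thesis by (simp add: assms)
  qed
  then show ?thesis
    by (simp add: quad_form_def sum.distrib[symmetric])
qed

text \<open>This is where the entrywise norm of the correlation matrix enters the variance bound;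
  \<open>u\<close> will be a gradient bounded by \<open>L\<close> in each coordinate.\<close>

lemma quad_form_le:
  assumes "\<And>i. i \<in> I \<Longrightarrow> \<bar>u i\<bar> \<le> L"
  shows "quad_form I C u \<le> L\<^sup>2 * (\<Sum>i\<in>I. \<Sum>j\<in>I. \<bar>C i j\<bar>)"
  unfolding quad_form_def sum_distrib_left
proof (intro sum_mono)
  fix i j assume "i \<in> I" "j \<in> I"
  then have "\<bar>u i\<bar> * \<bar>u j\<bar> \<le> L * L"
    by (intro mult_mono assms) (use assms[of i] in auto)
  then have "\<bar>u i\<bar> * \<bar>u j\<bar> * \<bar>C i j\<bar> \<le> L * L * \<bar>C i j\<bar>"
    by (rule mult_right_mono) simp
  moreover have "u i * C i j * u j \<le> \<bar>u i\<bar> * \<bar>u j\<bar> * \<bar>C i j\<bar>"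
    by (simp add: abs_mult[symmetric] mult_ac)
  ultimately show "u i * C i j * u j \<le> L\<^sup>2 * \<bar>C i j\<bar>"
    by (simp add: power2_eq_square)
qed

lemma gaussian_family_measurable:
  "gaussian_family M I X C \<Longrightarrow> i \<in> I \<Longrightarrow> X i \<in> borel_measurable M"
  by (auto simp: gaussian_family_def)

lemma gaussian_family_distr:
  assumes "gaussian_family M I X C"
  shows "distr M borel (\<lambda>\<omega>. \<Sum>i\<in>I. u i * X i \<omega>) =
    distr std_normal_distribution borel (\<lambda>x. sqrt (quad_form I C u) * x)"
  using assms normal_law_eq_distr[of "quad_form I C u"] by (simp add: gaussian_family_def)

lemma gaussian_family_char:
  assumes "gaussian_family M I X C"
  shows "(\<integral>\<omega>. iexp (\<Sum>i\<in>I. u i * X i \<omega>) \<partial>M) = of_real (exp (- quad_form I C u / 2))"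
proof -
  note gaussian_family_measurable[OF assms, measurable]
  have "(\<integral>\<omega>. iexp (\<Sum>i\<in>I. u i * X i \<omega>) \<partial>M) = (\<integral>x. iexp x \<partial>distr M borel (\<lambda>\<omega>. \<Sum>i\<in>I. u i * X i \<omega>))"
    by (subst integral_distr) auto
  also have "\<dots> = char std_normal_distribution (sqrt (quad_form I C u))"
    unfolding gaussian_family_distr[OF assms] char_def by (subst integral_distr) auto
  also have "\<dots> = of_real (exp (- quad_form I C u / 2))"
    using assms by (simp add: char_std_normal_distribution gaussian_family_def)
  finally show ?thesis .
qed

lemma gaussian_family_mgf:
  assumes "gaussian_family M I X C"
  shows "(\<integral>\<^sup>+\<omega>. ennreal (exp (\<Sum>i\<in>I. u i * X i \<omega>)) \<partial>M) = ennreal (exp (quad_form I C u / 2))"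
proof -
  note gaussian_family_measurable[OF assms, measurable]
  have "(\<integral>\<^sup>+\<omega>. ennreal (exp (\<Sum>i\<in>I. u i * X i \<omega>)) \<partial>M) =
      (\<integral>\<^sup>+x. ennreal (exp x) \<partial>distr M borel (\<lambda>\<omega>. \<Sum>i\<in>I. u i * X i \<omega>))"
    by (subst nn_integral_distr) auto
  also have "\<dots> = (\<integral>\<^sup>+x. ennreal (exp (sqrt (quad_form I C u) * x)) \<partial>std_normal_distribution)"
    unfolding gaussian_family_distr[OF assms] by (subst nn_integral_distr) auto
  also have "\<dots> = ennreal (exp (quad_form I C u / 2))"
    using assms by (simp add: nn_integral_exp_std_normal gaussian_family_def)
  finally show ?thesis .
qed

section \<open>Rotation of two independent copies\<close>

text \<open>
  The index \<open>(i, True)\<close> stands for the \<open>i\<close>-th component of the rotated vector, \<open>(i, False)\<close> for its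
  derivative with respect to the angle, where \<open>a\<close> and \<open>b\<close> are the sine and the cosine.
\<close>

definition rotated :: "('i \<Rightarrow> 'a \<Rightarrow> real) \<Rightarrow> real \<Rightarrow> real \<Rightarrow> 'i \<times> bool \<Rightarrow> 'a \<times> 'a \<Rightarrow> real" where
  "rotated X a b j \<omega> =
     (if snd j then a * X (fst j) (fst \<omega>) + b * X (fst j) (snd \<omega>)
      else b * X (fst j) (fst \<omega>) - a * X (fst j) (snd \<omega>))"

text \<open>The characteristic function of the rotated vector together with its derivative is
  computed for all \<open>a\<close> and \<open>b\<close> on the unit circle and turns out not to
  depend on them.\<close>

lemma gaussian_rotation_invariant:
  fixes X :: "'i \<Rightarrow> 'a \<Rightarrow> real"
  assumes M: "prob_space M" and I: "finite I" and G: "gaussian_family M I X C"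
    and ab: "a\<^sup>2 + b\<^sup>2 = 1" and cd: "c\<^sup>2 + d\<^sup>2 = 1"
  shows "distr (M \<Otimes>\<^sub>M M) (\<Pi>\<^sub>M j\<in>I \<times> UNIV. borel) (\<lambda>\<omega>. \<lambda>j\<in>I \<times> UNIV. rotated X a b j \<omega>) =
    distr (M \<Otimes>\<^sub>M M) (\<Pi>\<^sub>M j\<in>I \<times> UNIV. borel) (\<lambda>\<omega>. \<lambda>j\<in>I \<times> UNIV. rotated X c d j \<omega>)"
proof -
  interpret M: prob_space M by fact
  interpret MM: pair_prob_space M M ..
  note [measurable] = gaussian_family_measurable[OF G]
  have meas: "rotated X a b j \<in> borel_measurable (M \<Otimes>\<^sub>M M)" if "j \<in> I \<times> UNIV" for a b j
    using that unfolding rotated_def by (cases "snd j") auto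
  have char: "(\<integral>\<omega>. iexp (\<Sum>j\<in>I \<times> UNIV. u j * rotated X a b j \<omega>) \<partial>(M \<Otimes>\<^sub>M M)) =
      of_real (exp (- (quad_form I C (\<lambda>i. u (i, True)) + quad_form I C (\<lambda>i. u (i, False))) / 2))"
    if ab: "a\<^sup>2 + b\<^sup>2 = 1" for a b u
  proof -
    \<comment> \<open>\<open>p\<close> and \<open>q\<close> collect the coefficients of the first
      and of the second copy. The character then factors over the product measure.\<close>
    define p where "p = (\<lambda>i. a * u (i, True) + b * u (i, False))"
    define q where "q = (\<lambda>i. b * u (i, True) - a * u (i, False))"
    have "(\<Sum>j\<in>I \<times> UNIV. u j * rotated X a b j \<omega>) =
        (\<Sum>i\<in>I. p i * X i (fst \<omega>)) + (\<Sum>i\<in>I. q i * X i (snd \<omega>))" for \<omega>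
      unfolding sum.cartesian_product'
      by (simp add: UNIV_bool rotated_def p_def q_def sum.distrib[symmetric] algebra_simps)
    then have "(\<integral>\<omega>. iexp (\<Sum>j\<in>I \<times> UNIV. u j * rotated X a b j \<omega>) \<partial>(M \<Otimes>\<^sub>M M)) =
        (\<integral>\<omega>. iexp (\<Sum>i\<in>I. p i * X i (fst \<omega>)) * iexp (\<Sum>i\<in>I. q i * X i (snd \<omega>)) \<partial>(M \<Otimes>\<^sub>M M))"
      by (simp add: exp_add distrib_left)
    also have "\<dots> = (\<integral>x. \<integral>y. iexp (\<Sum>i\<in>I. p i * X i x) * iexp (\<Sum>i\<in>I. q i * X i y) \<partial>M \<partial>M)"
      by (subst MM.integral_fst'[symmetric])
        (auto intro!: MM.integrable_const_bound[of _ 1] simp: norm_mult simp del: of_real_sum of_real_mult)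
    also have "\<dots> = of_real (exp (- quad_form I C p / 2)) * of_real (exp (- quad_form I C q / 2))"
      by (simp only: integral_mult_right_zero integral_mult_left_zero gaussian_family_char[OF G])
    also have "\<dots> = of_real (exp (- (quad_form I C p + quad_form I C q) / 2))"
      by (simp add: exp_add[symmetric] add_divide_distrib of_real_mult[symmetric] del: of_real_mult)
    finally show ?thesis
      unfolding p_def q_def quad_form_rotate[OF ab] .
  qed
  show ?thesis
    by (rule distr_PiM_eq_of_char_eq)
      (use MM.prob_space_axioms I meas char[OF ab] char[OF cd] in auto)
qed

subsection \<open>Gaussian concentration\<close>

text \<open>The quarter circle leads from \<open>y\<close> at \<open>s = 0\<close> to
  \<open>x\<close> at \<open>s = 1\<close>, and \<open>g\<close> is the derivative of the sum along
  it. The fundamental theorem writes the difference as the mean of \<open>g\<close> under the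
  uniform law on the unit interval, and Jensen's inequality moves the exponential inside.\<close>

lemma exp_diff_le_rotation_average:
  fixes f f' :: "'i \<Rightarrow> real \<Rightarrow> real" and x y :: "'i \<Rightarrow> real"
  assumes deriv: "\<And>i x. i \<in> I \<Longrightarrow> (f i has_real_derivative f' i x) (at x)"
    and cont: "\<And>i. i \<in> I \<Longrightarrow> continuous_on UNIV (f' i)"
  defines "g \<equiv> \<lambda>s. \<Sum>i\<in>I. pi / 2 * f' i (sin (pi / 2 * s) * x i + cos (pi / 2 * s) * y i) *
      (cos (pi / 2 * s) * x i - sin (pi / 2 * s) * y i)"
  shows "ennreal (exp ((\<Sum>i\<in>I. f i (x i)) - (\<Sum>i\<in>I. f i (y i)))) \<le>
    (\<integral>\<^sup>+s. ennreal (exp (g s)) \<partial>restrict_space lborel {0..1})"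
proof -
  interpret U: prob_space "restrict_space lborel {0..1 :: real}"
    by (rule prob_space_restrict_space) auto
  define H where "H = (\<lambda>s. \<Sum>i\<in>I. f i (sin (pi / 2 * s) * x i + cos (pi / 2 * s) * y i))"
  have H: "DERIV H s :> g s" for s
    unfolding H_def g_def
  proof (rule DERIV_sum)
    fix i assume i: "i \<in> I"
    have "((\<lambda>s. sin (pi / 2 * s) * x i + cos (pi / 2 * s) * y i) has_real_derivative
        pi / 2 * (cos (pi / 2 * s) * x i - sin (pi / 2 * s) * y i)) (at s)"
      by (auto intro!: derivative_eq_intros simp: algebra_simps)
    from DERIV_chain2[OF deriv[OF i] this]
    show "((\<lambda>s. f i (sin (pi / 2 * s) * x i + cos (pi / 2 * s) * y i)) has_real_derivative
        pi / 2 * f' i (sin (pi / 2 * s) * x i + cos (pi / 2 * s) * y i) *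
        (cos (pi / 2 * s) * x i - sin (pi / 2 * s) * y i)) (at s)"
      by (simp only: mult_ac)
  qed
  have cont': "continuous_on UNIV (\<lambda>s. f' i (h s))" if "i \<in> I" "continuous_on UNIV h" for i h
    using continuous_on_compose2[OF cont[OF that(1)] that(2)] by auto
  have g: "continuous_on UNIV g"
    unfolding g_def by (intro continuous_intros cont') auto
  have "(\<integral>s. g s * indicator {0..1} s \<partial>lborel) = H 1 - H 0"
    by (rule integral_FTC_Icc_real) (use H g in \<open>auto simp: continuous_on_eq_continuous_at\<close>)
  then have "(\<integral>s. g s \<partial>restrict_space lborel {0..1}) = H 1 - H 0"
    by (simp add: integral_restrict_space mult.commute)
  also have "\<dots> = (\<Sum>i\<in>I. f i (x i)) - (\<Sum>i\<in>I. f i (y i))"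
    by (simp add: H_def)
  finally have Eg: "(\<integral>s. g s \<partial>restrict_space lborel {0..1}) = (\<Sum>i\<in>I. f i (x i)) - (\<Sum>i\<in>I. f i (y i))" .
  have int: "integrable (restrict_space lborel {0..1}) h" if "continuous_on UNIV h" for h :: "real \<Rightarrow> real"
    using borel_integrable_compact[of "{0..1}" h] continuous_on_subset[OF that]
    by (simp add: integrable_restrict_space indicator_scaleR_eq_if set_integrable_def)
  have exp_g: "continuous_on UNIV (\<lambda>s. exp (g s))"
    by (intro continuous_intros g)
  have "exp (\<integral>s. g s \<partial>restrict_space lborel {0..1}) \<le> (\<integral>s. exp (g s) \<partial>restrict_space lborel {0..1})"
    by (rule U.jensens_inequality[where I = UNIV]) (auto intro!: int g exp_g exp_convex)
  then have "ennreal (exp (\<integral>s. g s \<partial>restrict_space lborel {0..1})) \<le>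
      ennreal (\<integral>s. exp (g s) \<partial>restrict_space lborel {0..1})"
    by (rule ennreal_leI)
  also have "\<dots> = (\<integral>\<^sup>+s. ennreal (exp (g s)) \<partial>restrict_space lborel {0..1})"
    by (rule nn_integral_eq_integral[symmetric]) (auto intro!: int exp_g)
  finally show ?thesis unfolding Eg .
qed

text \<open>After exchanging the integrals, each angle contributes an integral that depends only on
  the joint law of the rotated vector and its derivative, hence equals the one for a convenient
  angle. The constant is \<open>(pi / 2)^2 / 2\<close>, the first factor coming from the speed on
  the quarter circle.\<close>

lemma gaussian_symmetrized_mgf_le:
  fixes X :: "'i \<Rightarrow> 'a \<Rightarrow> real" and f f' :: "'i \<Rightarrow> real \<Rightarrow> real"
  assumes M: "prob_space M" and I: "finite I" and G: "gaussian_family M I X C"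
    and deriv: "\<And>i x. i \<in> I \<Longrightarrow> (f i has_real_derivative f' i x) (at x)"
    and cont: "\<And>i. i \<in> I \<Longrightarrow> continuous_on UNIV (f' i)"
    and bound: "\<And>i x. i \<in> I \<Longrightarrow> \<bar>f' i x\<bar> \<le> L"
  shows "(\<integral>\<^sup>+\<omega>. ennreal (exp ((\<Sum>i\<in>I. f i (X i (fst \<omega>))) - (\<Sum>i\<in>I. f i (X i (snd \<omega>))))) \<partial>(M \<Otimes>\<^sub>M M))
    \<le> ennreal (exp (pi\<^sup>2 / 8 * L\<^sup>2 * (\<Sum>i\<in>I. \<Sum>j\<in>I. \<bar>C i j\<bar>)))" (is "_ \<le> ?K")
proof -
  interpret M: prob_space M by fact
  interpret MM: pair_prob_space M M ..
  interpret U: prob_space "restrict_space lborel {0..1 :: real}"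
    by (rule prob_space_restrict_space) auto
  interpret UM: pair_sigma_finite "restrict_space lborel {0..1 :: real}" "M \<Otimes>\<^sub>M M" ..
  note [measurable] = gaussian_family_measurable[OF G]
  have [measurable]: "f' i \<in> borel_measurable borel" if "i \<in> I" for i
    using cont[OF that] by (rule borel_measurable_continuous_onI)
  have [measurable]: "(\<lambda>x. x) \<in> borel_measurable (restrict_space lborel {0..1 :: real})"
    by (rule measurable_restrict_space1) simp
  \<comment> \<open>A functional of the joint vector, so that its integral is determined by the law
    that rotations preserve.\<close>
  define h where "h = (\<lambda>z. ennreal (exp (\<Sum>i\<in>I. pi / 2 * f' i (z (i, True)) * z (i, False))))"
  have h[measurable]: "h \<in> borel_measurable (\<Pi>\<^sub>M j\<in>I \<times> (UNIV :: bool set). borel)"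
    unfolding h_def by measurable
  have h_rotated: "h (\<lambda>j\<in>I \<times> UNIV. rotated X a b j \<omega>) = ennreal (exp (\<Sum>i\<in>I. pi / 2 *
      f' i (a * X i (fst \<omega>) + b * X i (snd \<omega>)) * (b * X i (fst \<omega>) - a * X i (snd \<omega>))))" for a b \<omega>
    by (simp add: h_def rotated_def)
  have [measurable]: "(\<lambda>\<omega>. \<lambda>j\<in>I \<times> UNIV. rotated X a b j \<omega>) \<in> (M \<Otimes>\<^sub>M M) \<rightarrow>\<^sub>M (\<Pi>\<^sub>M j\<in>I \<times> UNIV. borel)" for a b
  proof (rule measurable_restrict)
    show "rotated X a b j \<in> borel_measurable (M \<Otimes>\<^sub>M M)" if "j \<in> I \<times> UNIV" for j
      using that unfolding rotated_def by (cases "snd j") auto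
  qed
  have rot: "(\<integral>\<^sup>+\<omega>. h (\<lambda>j\<in>I \<times> UNIV. rotated X a b j \<omega>) \<partial>(M \<Otimes>\<^sub>M M)) \<le> ?K" if "a\<^sup>2 + b\<^sup>2 = 1" for a b
  proof -
    have "(\<integral>\<^sup>+\<omega>. h (\<lambda>j\<in>I \<times> UNIV. rotated X a b j \<omega>) \<partial>(M \<Otimes>\<^sub>M M)) =
        (\<integral>\<^sup>+z. h z \<partial>distr (M \<Otimes>\<^sub>M M) (\<Pi>\<^sub>M j\<in>I \<times> UNIV. borel) (\<lambda>\<omega>. \<lambda>j\<in>I \<times> UNIV. rotated X a b j \<omega>))"
      by (subst nn_integral_distr) auto
    \<comment> \<open>For \<open>a = -1\<close> and \<open>b = 0\<close> the position is minus the
      first copy and the derivative is the second copy, which are independent.\<close>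
    also have "\<dots> = (\<integral>\<^sup>+z. h z \<partial>distr (M \<Otimes>\<^sub>M M) (\<Pi>\<^sub>M j\<in>I \<times> UNIV. borel) (\<lambda>\<omega>. \<lambda>j\<in>I \<times> UNIV. rotated X (-1) 0 j \<omega>))"
      by (subst gaussian_rotation_invariant[OF M I G that, of "-1" 0]) auto
    also have "\<dots> = (\<integral>\<^sup>+\<omega>. h (\<lambda>j\<in>I \<times> UNIV. rotated X (-1) 0 j \<omega>) \<partial>(M \<Otimes>\<^sub>M M))"
      by (subst nn_integral_distr) auto
    also have "\<dots> = (\<integral>\<^sup>+x. \<integral>\<^sup>+y. ennreal (exp (\<Sum>i\<in>I. pi / 2 * f' i (- X i x) * X i y)) \<partial>M \<partial>M)"
      unfolding h_rotated by (subst M.nn_integral_fst[symmetric]) simp_all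
    \<comment> \<open>With the first copy fixed, the exponent is linear in the second one, so the
      inner integral is a Gaussian moment generating function.\<close>
    also have "\<dots> = (\<integral>\<^sup>+x. ennreal (exp (quad_form I C (\<lambda>i. pi / 2 * f' i (- X i x)) / 2)) \<partial>M)"
      unfolding gaussian_family_mgf[OF G] ..
    also have "\<dots> \<le> (\<integral>\<^sup>+x. ?K \<partial>M)"
    proof (intro nn_integral_mono ennreal_leI)
      fix x
      have "quad_form I C (\<lambda>i. pi / 2 * f' i (- X i x)) \<le> (pi / 2 * L)\<^sup>2 * (\<Sum>i\<in>I. \<Sum>j\<in>I. \<bar>C i j\<bar>)"
        by (rule quad_form_le) (simp add: abs_mult bound)
      then show "exp (quad_form I C (\<lambda>i. pi / 2 * f' i (- X i x)) / 2) \<le>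
          exp (pi\<^sup>2 / 8 * L\<^sup>2 * (\<Sum>i\<in>I. \<Sum>j\<in>I. \<bar>C i j\<bar>))"
        by (simp add: power_mult_distrib power_divide)
    qed
    also have "\<dots> = ?K" by (simp add: M.emeasure_space_1)
    finally show ?thesis .
  qed
  have "(\<integral>\<^sup>+\<omega>. ennreal (exp ((\<Sum>i\<in>I. f i (X i (fst \<omega>))) - (\<Sum>i\<in>I. f i (X i (snd \<omega>))))) \<partial>(M \<Otimes>\<^sub>M M)) \<le>
      (\<integral>\<^sup>+\<omega>. \<integral>\<^sup>+s. h (\<lambda>j\<in>I \<times> UNIV. rotated X (sin (pi / 2 * s)) (cos (pi / 2 * s)) j \<omega>)
        \<partial>restrict_space lborel {0..1} \<partial>(M \<Otimes>\<^sub>M M))"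
    unfolding h_rotated by (intro nn_integral_mono exp_diff_le_rotation_average deriv cont)
  also have "\<dots> = (\<integral>\<^sup>+s. \<integral>\<^sup>+\<omega>. h (\<lambda>j\<in>I \<times> UNIV. rotated X (sin (pi / 2 * s)) (cos (pi / 2 * s)) j \<omega>)
        \<partial>(M \<Otimes>\<^sub>M M) \<partial>restrict_space lborel {0..1})"
    unfolding h_rotated by (rule UM.Fubini') measurable
  also have "\<dots> \<le> (\<integral>\<^sup>+s. ?K \<partial>restrict_space lborel {0..1 :: real})"
    by (intro nn_integral_mono rot) simp
  also have "\<dots> = ?K" by (simp only: nn_integral_const U.emeasure_space_1 mult_1_right)
  finally show ?thesis .
qed

text \<open>Jensen's inequality over an independent copy replaces the mean by that copy, which
  reduces the claim to the symmetrized bound. The bound \<open>B\<close> provides the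
  integrability.\<close>

lemma gaussian_centered_mgf_le:
  fixes X :: "'i \<Rightarrow> 'a \<Rightarrow> real" and f f' :: "'i \<Rightarrow> real \<Rightarrow> real"
  assumes M: "prob_space M" and I: "finite I" and G: "gaussian_family M I X C"
    and deriv: "\<And>i x. i \<in> I \<Longrightarrow> (f i has_real_derivative f' i x) (at x)"
    and cont: "\<And>i. i \<in> I \<Longrightarrow> continuous_on UNIV (f' i)"
    and bound: "\<And>i x. i \<in> I \<Longrightarrow> \<bar>f' i x\<bar> \<le> L"
    and f_bound: "\<And>i x. i \<in> I \<Longrightarrow> \<bar>f i x\<bar> \<le> B"
  shows "(\<integral>\<^sup>+\<omega>. ennreal (exp ((\<Sum>i\<in>I. f i (X i \<omega>)) - (\<integral>\<omega>'. (\<Sum>i\<in>I. f i (X i \<omega>')) \<partial>M))) \<partial>M)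
    \<le> ennreal (exp (pi\<^sup>2 / 8 * L\<^sup>2 * (\<Sum>i\<in>I. \<Sum>j\<in>I. \<bar>C i j\<bar>)))"
proof -
  interpret M: prob_space M by fact
  note [measurable] = gaussian_family_measurable[OF G]
  have [measurable]: "f i \<in> borel_measurable borel" if "i \<in> I" for i
    using DERIV_continuous[OF deriv[OF that]]
    by (intro borel_measurable_continuous_onI) (simp add: continuous_at_imp_continuous_on)
  define F where "F = (\<lambda>\<omega>. \<Sum>i\<in>I. f i (X i \<omega>))"
  have [measurable]: "F \<in> borel_measurable M" unfolding F_def by measurable
  have F_le: "\<bar>F \<omega>\<bar> \<le> card I * B" for \<omega>
    unfolding F_def using sum_bounded_above[of I "\<lambda>i. \<bar>f i (X i \<omega>)\<bar>" B] f_bound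
    by (intro order_trans[OF sum_abs]) auto
  have intF: "integrable M F"
    by (rule M.integrable_const_bound[of _ "card I * B"]) (use F_le in auto)
  have exp_int: "integrable M (\<lambda>\<omega>'. exp (F \<omega> - F \<omega>'))" for \<omega>
  proof (rule M.integrable_const_bound[of _ "exp (2 * (card I * B))"])
    show "AE \<omega>' in M. norm (exp (F \<omega> - F \<omega>')) \<le> exp (2 * (card I * B))"
      using F_le[of \<omega>] F_le by (intro AE_I2) (simp add: abs_le_iff, smt (verit))
  qed simp
  have jensen: "ennreal (exp (F \<omega> - (\<integral>\<omega>'. F \<omega>' \<partial>M))) \<le> (\<integral>\<^sup>+\<omega>'. ennreal (exp (F \<omega> - F \<omega>')) \<partial>M)" for \<omega>
  proof -
    have "exp (\<integral>\<omega>'. F \<omega> - F \<omega>' \<partial>M) \<le> (\<integral>\<omega>'. exp (F \<omega> - F \<omega>') \<partial>M)"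
      by (rule M.jensens_inequality[where I = UNIV]) (auto intro!: intF exp_int exp_convex)
    then have "ennreal (exp (F \<omega> - (\<integral>\<omega>'. F \<omega>' \<partial>M))) \<le> ennreal (\<integral>\<omega>'. exp (F \<omega> - F \<omega>') \<partial>M)"
      by (intro ennreal_leI) (simp add: intF M.prob_space)
    also have "\<dots> = (\<integral>\<^sup>+\<omega>'. ennreal (exp (F \<omega> - F \<omega>')) \<partial>M)"
      by (rule nn_integral_eq_integral[symmetric]) (auto intro!: exp_int)
    finally show ?thesis .
  qed
  have "(\<integral>\<^sup>+\<omega>. ennreal (exp (F \<omega> - (\<integral>\<omega>'. F \<omega>' \<partial>M))) \<partial>M) \<le>
      (\<integral>\<^sup>+\<omega>. \<integral>\<^sup>+\<omega>'. ennreal (exp (F \<omega> - F \<omega>')) \<partial>M \<partial>M)"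
    by (intro nn_integral_mono jensen)
  also have "\<dots> = (\<integral>\<^sup>+\<omega>. ennreal (exp (F (fst \<omega>) - F (snd \<omega>))) \<partial>(M \<Otimes>\<^sub>M M))"
    by (subst M.nn_integral_fst[symmetric]) simp_all
  also have "\<dots> \<le> ennreal (exp (pi\<^sup>2 / 8 * L\<^sup>2 * (\<Sum>i\<in>I. \<Sum>j\<in>I. \<bar>C i j\<bar>)))"
    unfolding F_def by (rule gaussian_symmetrized_mgf_le[OF M I G deriv cont bound])
  finally show ?thesis unfolding F_def .
qed

text \<open>Chernoff's method. The majorant \<open>K\<close> is positive even if the sum on the left
  vanishes, so the exponent can be optimized by division.\<close>

lemma gaussian_upper_tail:
  fixes X :: "'i \<Rightarrow> 'a \<Rightarrow> real" and f f' :: "'i \<Rightarrow> real \<Rightarrow> real"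
  assumes M: "prob_space M" and I: "finite I" and G: "gaussian_family M I X C"
    and deriv: "\<And>i x. i \<in> I \<Longrightarrow> (f i has_real_derivative f' i x) (at x)"
    and cont: "\<And>i. i \<in> I \<Longrightarrow> continuous_on UNIV (f' i)"
    and bound: "\<And>i x. i \<in> I \<Longrightarrow> \<bar>f' i x\<bar> \<le> L"
    and f_bound: "\<And>i x. i \<in> I \<Longrightarrow> \<bar>f i x\<bar> \<le> B"
    and K: "L\<^sup>2 * (\<Sum>i\<in>I. \<Sum>j\<in>I. \<bar>C i j\<bar>) \<le> K" "0 < K" and \<epsilon>: "0 \<le> \<epsilon>"
  shows "measure M {\<omega> \<in> space M. (\<Sum>i\<in>I. f i (X i \<omega>)) - (\<integral>\<omega>'. (\<Sum>i\<in>I. f i (X i \<omega>')) \<partial>M) \<ge> \<epsilon>}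
    \<le> exp (- (2 * \<epsilon>\<^sup>2 / (pi\<^sup>2 * K)))"
proof -
  interpret M: prob_space M by fact
  note [measurable] = gaussian_family_measurable[OF G]
  have [measurable]: "f i \<in> borel_measurable borel" if "i \<in> I" for i
    using DERIV_continuous[OF deriv[OF that]]
    by (intro borel_measurable_continuous_onI) (simp add: continuous_at_imp_continuous_on)
  \<comment> \<open>The minimizer of
    \<open>- l * \<epsilon> + pi\<^sup>2 / 8 * l\<^sup>2 * K\<close> over \<open>l\<close>.\<close>
  define l where "l = 4 * \<epsilon> / (pi\<^sup>2 * K)"
  have l: "0 \<le> l" using K \<epsilon> by (simp add: l_def)
  define D where "D = (\<lambda>\<omega>. (\<Sum>i\<in>I. f i (X i \<omega>)) - (\<integral>\<omega>'. (\<Sum>i\<in>I. f i (X i \<omega>')) \<partial>M))"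
  have [measurable]: "D \<in> borel_measurable M" unfolding D_def by measurable
  have "(\<integral>\<^sup>+\<omega>. ennreal (exp (l * D \<omega>)) \<partial>M) =
    (\<integral>\<^sup>+\<omega>. ennreal (exp ((\<Sum>i\<in>I. l * f i (X i \<omega>)) - (\<integral>\<omega>'. (\<Sum>i\<in>I. l * f i (X i \<omega>')) \<partial>M))) \<partial>M)"
    by (simp add: D_def sum_distrib_left[symmetric] right_diff_distrib)
  also have "\<dots> \<le> ennreal (exp (pi\<^sup>2 / 8 * (l * L)\<^sup>2 * (\<Sum>i\<in>I. \<Sum>j\<in>I. \<bar>C i j\<bar>)))"
  proof (rule gaussian_centered_mgf_le[OF M I G, where f' = "\<lambda>i x. l * f' i x" and B = "l * B"])
    show "\<And>i x. i \<in> I \<Longrightarrow> ((\<lambda>x. l * f i x) has_real_derivative l * f' i x) (at x)"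
      by (auto intro!: derivative_eq_intros deriv)
    show "\<And>i. i \<in> I \<Longrightarrow> continuous_on UNIV (\<lambda>x. l * f' i x)"
      by (intro continuous_intros cont)
  qed (use l bound f_bound in \<open>auto simp: abs_mult intro!: mult_left_mono\<close>)
  also have "\<dots> \<le> ennreal (exp (pi\<^sup>2 / 8 * l\<^sup>2 * K))"
    using mult_left_mono[OF K(1), of "pi\<^sup>2 / 8 * l\<^sup>2"]
    by (intro ennreal_leI) (simp add: power_mult_distrib mult_ac)
  finally have mgf: "(\<integral>\<^sup>+\<omega>. ennreal (exp (l * D \<omega>)) \<partial>M) \<le> ennreal (exp (pi\<^sup>2 / 8 * l\<^sup>2 * K))" .
  \<comment> \<open>Markov's inequality for \<open>exp (l * D \<omega>)\<close>, with the event
    rewritten so that the threshold is 1.\<close>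
  have "emeasure M {\<omega> \<in> space M. \<epsilon> \<le> D \<omega>} \<le>
      emeasure M {\<omega> \<in> space M. 1 \<le> ennreal (exp (- l * \<epsilon>)) * ennreal (exp (l * D \<omega>))}"
  proof (rule emeasure_mono)
    have "1 \<le> ennreal (exp (- l * \<epsilon>)) * ennreal (exp (l * D \<omega>))" if "\<epsilon> \<le> D \<omega>" for \<omega>
      using l that by (simp add: ennreal_mult[symmetric] exp_add[symmetric] mult_left_mono
          ennreal_1[symmetric] ennreal_le_iff del: ennreal_1)
    then show "{\<omega> \<in> space M. \<epsilon> \<le> D \<omega>} \<subseteq> {\<omega> \<in> space M. 1 \<le> ennreal (exp (- l * \<epsilon>)) * ennreal (exp (l * D \<omega>))}"
      by auto
  qed measurable
  also have "\<dots> \<le> ennreal (exp (- l * \<epsilon>)) * (\<integral>\<^sup>+\<omega>. ennreal (exp (l * D \<omega>)) * indicator (space M) \<omega> \<partial>M)"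
    by (rule nn_integral_Markov_inequality[where A = "space M", simplified]) auto
  also have "(\<integral>\<^sup>+\<omega>. ennreal (exp (l * D \<omega>)) * indicator (space M) \<omega> \<partial>M) = (\<integral>\<^sup>+\<omega>. ennreal (exp (l * D \<omega>)) \<partial>M)"
    by (intro nn_integral_cong) simp
  also have "ennreal (exp (- l * \<epsilon>)) * \<dots> \<le> ennreal (exp (- l * \<epsilon>)) * ennreal (exp (pi\<^sup>2 / 8 * l\<^sup>2 * K))"
    by (intro mult_left_mono mgf) simp
  also have "\<dots> = ennreal (exp (- (2 * \<epsilon>\<^sup>2 / (pi\<^sup>2 * K))))"
  proof -
    have "- l * \<epsilon> + pi\<^sup>2 / 8 * l\<^sup>2 * K = - (2 * \<epsilon>\<^sup>2 / (pi\<^sup>2 * K))"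
      using K(2) by (simp add: l_def field_simps power2_eq_square)
    then show ?thesis
      by (simp add: ennreal_mult[symmetric] exp_add[symmetric])
  qed
  finally show ?thesis
    unfolding D_def M.emeasure_eq_measure by (simp add: ennreal_le_iff)
qed

text \<open>The upper tail bound for \<open>f\<close> and for \<open>- f\<close>, joined by a union
  bound.\<close>

lemma gaussian_concentration:
  fixes X :: "'i \<Rightarrow> 'a \<Rightarrow> real" and f f' :: "'i \<Rightarrow> real \<Rightarrow> real"
  assumes M: "prob_space M" and I: "finite I" and G: "gaussian_family M I X C"
    and deriv: "\<And>i x. i \<in> I \<Longrightarrow> (f i has_real_derivative f' i x) (at x)"
    and cont: "\<And>i. i \<in> I \<Longrightarrow> continuous_on UNIV (f' i)"
    and bound: "\<And>i x. i \<in> I \<Longrightarrow> \<bar>f' i x\<bar> \<le> L"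
    and f_bound: "\<And>i x. i \<in> I \<Longrightarrow> \<bar>f i x\<bar> \<le> B"
    and K: "L\<^sup>2 * (\<Sum>i\<in>I. \<Sum>j\<in>I. \<bar>C i j\<bar>) \<le> K" "0 < K" and \<epsilon>: "0 \<le> \<epsilon>"
  shows "measure M {\<omega> \<in> space M. \<bar>(\<Sum>i\<in>I. f i (X i \<omega>)) - (\<integral>\<omega>'. (\<Sum>i\<in>I. f i (X i \<omega>')) \<partial>M)\<bar> \<ge> \<epsilon>}
    \<le> 2 * exp (- (2 * \<epsilon>\<^sup>2 / (pi\<^sup>2 * K)))"
proof -
  interpret M: prob_space M by fact
  note [measurable] = gaussian_family_measurable[OF G]
  have [measurable]: "f i \<in> borel_measurable borel" if "i \<in> I" for i
    using DERIV_continuous[OF deriv[OF that]]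
    by (intro borel_measurable_continuous_onI) (simp add: continuous_at_imp_continuous_on)
  define D where "D = (\<lambda>(f :: 'i \<Rightarrow> real \<Rightarrow> real) \<omega>. (\<Sum>i\<in>I. f i (X i \<omega>)) - (\<integral>\<omega>'. (\<Sum>i\<in>I. f i (X i \<omega>')) \<partial>M))"
  have [measurable]: "D f \<in> borel_measurable M" "D (\<lambda>i x. - f i x) \<in> borel_measurable M"
    unfolding D_def by measurable
  have D_minus: "D (\<lambda>i x. - f i x) \<omega> = - D f \<omega>" for \<omega>
    by (simp add: D_def sum_negf)
  have 1: "measure M {\<omega> \<in> space M. D f \<omega> \<ge> \<epsilon>} \<le> exp (- (2 * \<epsilon>\<^sup>2 / (pi\<^sup>2 * K)))"
    unfolding D_def by (rule gaussian_upper_tail) (use assms in auto)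
  have 2: "measure M {\<omega> \<in> space M. D (\<lambda>i x. - f i x) \<omega> \<ge> \<epsilon>} \<le> exp (- (2 * \<epsilon>\<^sup>2 / (pi\<^sup>2 * K)))"
    unfolding D_def
    by (rule gaussian_upper_tail[OF M I G, where f' = "\<lambda>i x. - f' i x"])
      (use assms in \<open>auto intro!: derivative_eq_intros continuous_intros\<close>)
  have "measure M {\<omega> \<in> space M. \<bar>D f \<omega>\<bar> \<ge> \<epsilon>} \<le>
      measure M ({\<omega> \<in> space M. D f \<omega> \<ge> \<epsilon>} \<union> {\<omega> \<in> space M. D (\<lambda>i x. - f i x) \<omega> \<ge> \<epsilon>})"
    by (rule M.finite_measure_mono) (auto simp: D_minus)
  also have "\<dots> \<le> measure M {\<omega> \<in> space M. D f \<omega> \<ge> \<epsilon>} + measure M {\<omega> \<in> space M. D (\<lambda>i x. - f i x) \<omega> \<ge> \<epsilon>}"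
    by (rule measure_Un_le) measurable
  finally show ?thesis using 1 2 by (simp add: D_def)
qed

subsection \<open>Smooth steps\<close>

text \<open>The quadratic spline with knots 0, 1/2 and 1 that rises from 0 to 1 with a continuous
  derivative, written in truncated powers.\<close>

definition smooth_step :: "real \<Rightarrow> real" where
  "smooth_step x = 2 * ((max 0 x)\<^sup>2 - 2 * (max 0 (x - 1 / 2))\<^sup>2 + (max 0 (x - 1))\<^sup>2)"

text \<open>The derivative of \<open>smooth_step\<close>: the triangular function on the unit
  interval with peak 2 at 1/2.\<close>

definition tent :: "real \<Rightarrow> real" where
  "tent x = 4 * (max 0 x - 2 * max 0 (x - 1 / 2) + max 0 (x - 1))"

text \<open>Only the point 0 is delicate; there the difference quotient is \<open>max 0 h\<close>,
  which tends to 0.\<close>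

lemma DERIV_max_0_power2: "((\<lambda>x. (max 0 x)\<^sup>2) has_real_derivative 2 * max 0 x) (at x)" for x :: real
proof -
  consider "x < 0" | "x = 0" | "x > 0" by linarith
  then show ?thesis
  proof cases
    case 1
    have "((\<lambda>x. 0) has_real_derivative 2 * max 0 x) (at x)" using 1 by simp
    then show ?thesis
      by (rule has_field_derivative_transform_within_open[where S = "{..<0}"]) (use 1 in auto)
  next
    case 2
    have "((\<lambda>h::real. max 0 h) \<longlongrightarrow> max 0 0) (at 0)"
      by (intro tendsto_intros)
    moreover have "(max 0 (0 + h))\<^sup>2 / h = max 0 h" for h :: real
      by (simp add: max_def power2_eq_square)
    ultimately show ?thesis
      using 2 by (simp add: DERIV_def)
  next
    case 3
    have "((\<lambda>x. x\<^sup>2) has_real_derivative 2 * max 0 x) (at x)"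
      using 3 by (auto intro!: derivative_eq_intros)
    then show ?thesis
      by (rule has_field_derivative_transform_within_open[where S = "{0<..}"]) (use 3 in auto)
  qed
qed

lemma DERIV_smooth_step: "(smooth_step has_real_derivative tent x) (at x)"
proof -
  have d: "((\<lambda>x. (max 0 (x - c))\<^sup>2) has_real_derivative 2 * max 0 (x - c) * 1) (at x)" for c
    by (rule DERIV_chain2[OF DERIV_max_0_power2]) (auto intro!: derivative_eq_intros)
  have "((\<lambda>x. 2 * ((max 0 (x - 0))\<^sup>2 - 2 * (max 0 (x - 1 / 2))\<^sup>2 + (max 0 (x - 1))\<^sup>2))
      has_real_derivative 2 * (2 * max 0 (x - 0) * 1 - 2 * (2 * max 0 (x - 1 / 2) * 1)
        + 2 * max 0 (x - 1) * 1)) (at x)"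
    by (intro DERIV_cmult DERIV_add DERIV_diff d)
  then show ?thesis by (simp add: smooth_step_def[abs_def] tent_def algebra_simps)
qed

lemma continuous_on_tent: "continuous_on UNIV tent"
  unfolding tent_def[abs_def] by (intro continuous_intros)

lemma tent_bounds: "0 \<le> tent x" "tent x \<le> 2"
proof -
  consider "x \<le> 0" | "0 \<le> x" "x \<le> 1 / 2" | "1 / 2 \<le> x" "x \<le> 1" | "1 \<le> x" by linarith
  then have "0 \<le> tent x \<and> tent x \<le> 2"
    by cases (simp_all add: tent_def)
  then show "0 \<le> tent x" "tent x \<le> 2" by auto
qed

lemma smooth_step_eq_0: "x \<le> 0 \<Longrightarrow> smooth_step x = 0"
  by (simp add: smooth_step_def max_def)

lemma smooth_step_eq_1: "1 \<le> x \<Longrightarrow> smooth_step x = 1"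
  by (simp add: smooth_step_def max_def power2_eq_square algebra_simps)

lemma smooth_step_bounds: "0 \<le> smooth_step x" "smooth_step x \<le> 1"
proof -
  have mono: "a \<le> b \<Longrightarrow> smooth_step a \<le> smooth_step b" for a b
    by (erule DERIV_nonneg_imp_nondecreasing) (use DERIV_smooth_step tent_bounds in auto)
  show "0 \<le> smooth_step x"
    using mono[of "min 0 x" x] smooth_step_eq_0[of "min 0 x"] by simp
  show "smooth_step x \<le> 1"
    using mono[of x "max 1 x"] smooth_step_eq_1[of "max 1 x"] by simp
qed

definition C1_bounded :: "real \<Rightarrow> (real \<Rightarrow> real) \<Rightarrow> (real \<Rightarrow> real) \<Rightarrow> bool" where
  "C1_bounded L f f' \<longleftrightarrow> (\<forall>x. (f has_real_derivative f' x) (at x)) \<and> continuous_on UNIV f' \<and>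
     (\<forall>x. \<bar>f x\<bar> \<le> 1) \<and> (\<forall>x. \<bar>f' x\<bar> \<le> L)"

text \<open>The offset \<open>c\<close> places the rise: for \<open>c = 0\<close> it takes place
  between \<open>a\<close> and \<open>a + \<epsilon>\<close>, for \<open>c = 1\<close> between
  \<open>a - \<epsilon>\<close> and \<open>a\<close>.\<close>

lemma C1_bounded_smooth_step:
  assumes "0 < \<epsilon>"
  shows "C1_bounded (2 / \<epsilon>) (\<lambda>x. smooth_step ((x - a) / \<epsilon> + c)) (\<lambda>x. tent ((x - a) / \<epsilon> + c) / \<epsilon>)"
proof -
  have "((\<lambda>x. smooth_step ((x - a) / \<epsilon> + c)) has_real_derivative tent ((x - a) / \<epsilon> + c) * (1 / \<epsilon>)) (at x)" for x
    by (rule DERIV_chain2[OF DERIV_smooth_step]) (use assms in \<open>auto intro!: derivative_eq_intros\<close>)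
  moreover have "continuous_on UNIV (\<lambda>x. tent ((x - a) / \<epsilon> + c) / \<epsilon>)"
    by (intro continuous_intros continuous_on_compose2[OF continuous_on_tent]) (use assms in auto)
  ultimately show ?thesis
    using assms tent_bounds smooth_step_bounds
    by (auto simp: C1_bounded_def divide_right_mono)
qed

text \<open>A nontrivial upper set is an open or closed half-line with endpoint \<open>a\<close>.
  One step rises to the right of \<open>a\<close>, the other to its left, and they differ only
  within distance \<open>\<epsilon>\<close> of \<open>a\<close>.\<close>

lemma upper_set_smooth_sandwich:
  fixes U :: "real set"
  assumes U: "\<And>x y. x \<in> U \<Longrightarrow> x \<le> y \<Longrightarrow> y \<in> U" and \<epsilon>: "0 < \<epsilon>"
  shows "\<exists>f f' g g' a. C1_bounded (2 / \<epsilon>) f f' \<and> C1_bounded (2 / \<epsilon>) g g' \<and>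
    (\<forall>x. f x \<le> indicator U x \<and> indicator U x \<le> g x \<and> g x - f x \<le> indicator {a - \<epsilon>..a + \<epsilon>} x)"
proof -
  consider "U = {}" | "U = UNIV" | "U \<noteq> {}" "U \<noteq> UNIV" by blast
  then show ?thesis
  proof cases
    case 1
    \<comment> \<open>The empty set and the whole line have no endpoint; constants match them
      exactly.\<close>
    have "C1_bounded (2 / \<epsilon>) (\<lambda>_. 0) (\<lambda>_. 0)" using \<epsilon> by (simp add: C1_bounded_def)
    then show ?thesis using 1
      by (intro exI[of _ "\<lambda>_. 0"] exI[of _ 0]) auto
  next
    case 2
    have "C1_bounded (2 / \<epsilon>) (\<lambda>_. 1) (\<lambda>_. 0)" using \<epsilon> by (simp add: C1_bounded_def)
    then show ?thesis using 2
      by (intro exI[of _ "\<lambda>_. 1"] exI[of _ "\<lambda>_. 0"] exI[of _ "0 :: real"]) auto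
  next
    case 3
    then obtain b where b: "b \<notin> U" by blast
    \<comment> \<open>A point outside an upper set is a lower bound of it.\<close>
    have "bdd_below U" using U b by (intro bdd_belowI[of _ b]) (meson linear)
    define a where "a = Inf U"
    have ge: "a \<le> x" if "x \<in> U" for x
      unfolding a_def using that \<open>bdd_below U\<close> by (rule cInf_lower)
    have gt: "x \<in> U" if "a < x" for x
    proof -
      from that obtain y where "y \<in> U" "y < x"
        unfolding a_def using 3 \<open>bdd_below U\<close> by (subst (asm) cInf_less_iff) auto
      then show ?thesis using U[of y x] by simp
    qed
    have "smooth_step ((x - a) / \<epsilon> + 0) \<le> indicator U x" for x
      using gt[of x] smooth_step_eq_0[of "(x - a) / \<epsilon>"] smooth_step_bounds \<epsilon>
      by (cases "a < x") (auto simp: divide_le_0_iff)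
    moreover have "indicator U x \<le> smooth_step ((x - a) / \<epsilon> + 1)" for x
      using ge[of x] smooth_step_eq_1[of "(x - a) / \<epsilon> + 1"] smooth_step_bounds \<epsilon>
      by (cases "x \<in> U") auto
    moreover have "smooth_step ((x - a) / \<epsilon> + 1) - smooth_step ((x - a) / \<epsilon> + 0) \<le>
        indicator {a - \<epsilon>..a + \<epsilon>} x" for x
    proof -
      consider "x < a - \<epsilon>" | "a + \<epsilon> < x" | "x \<in> {a - \<epsilon>..a + \<epsilon>}" by fastforce
      then show ?thesis
      proof cases
        case 1
        then have "(x - a) / \<epsilon> + 1 \<le> 0" using \<epsilon> by (simp add: field_simps)
        then show ?thesis by (simp add: smooth_step_eq_0)
      next
        case 2
        then have "1 \<le> (x - a) / \<epsilon>" using \<epsilon> by (simp add: field_simps)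
        then show ?thesis by (simp add: smooth_step_eq_1)
      next
        case 3
        then show ?thesis
          using smooth_step_bounds[of "(x - a) / \<epsilon> + 1"] smooth_step_bounds[of "(x - a) / \<epsilon>"] by simp
      qed
    qed
    ultimately show ?thesis
      using C1_bounded_smooth_step[OF \<epsilon>, of a] by blast
  qed
qed

section \<open>Standardized components, short intervals and summability of the tail bounds\<close>

lemma gaussian_family_std_normal:
  assumes G: "gaussian_family M I X C" and I: "finite I" "i \<in> I" and C: "C i i = 1"
  shows "distr M borel (X i) = std_normal_distribution"
proof -
  define e where "e = (\<lambda>j. if j = i then 1 else 0 :: real)"
  have "quad_form I C e = 1"
    using I C by (simp add: quad_form_def e_def if_distrib[of "\<lambda>y. y * _"] if_distrib[of "\<lambda>y. _ * y"] cong: if_cong)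
  moreover have "(\<Sum>j\<in>I. e j * X j \<omega>) = X i \<omega>" for \<omega>
    using I by (simp add: e_def if_distrib[of "\<lambda>y. y * _"] cong: if_cong)
  ultimately show ?thesis
    using G[unfolded gaussian_family_def, THEN conjunct2, rule_format, of e]
    by (simp add: normal_law_def)
qed

text \<open>The density is at most 1. The bound is uniform in \<open>a\<close>, so it serves all
  thresholds at once.\<close>

lemma std_normal_interval_le:
  assumes "0 \<le> \<epsilon>"
  shows "measure std_normal_distribution {a - \<epsilon>..a + \<epsilon>} \<le> 2 * \<epsilon>"
proof -
  have "sqrt (2 * pi) \<ge> 1" using pi_ge_two by simp
  then have "1 / sqrt (2 * pi) * exp (- x\<^sup>2 / 2) \<le> 1 * 1" for x :: real
    by (intro mult_mono) auto
  then have "std_normal_density x \<le> 1" for x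
    by (simp add: std_normal_density_def)
  then have "ennreal (std_normal_density x) * indicator {a - \<epsilon>..a + \<epsilon>} x \<le> indicator {a - \<epsilon>..a + \<epsilon>} x" for x
    by (simp add: indicator_def ennreal_le_1)
  then have "emeasure std_normal_distribution {a - \<epsilon>..a + \<epsilon>} \<le> (\<integral>\<^sup>+x. indicator {a - \<epsilon>..a + \<epsilon>} x \<partial>lborel)"
    by (subst emeasure_density) (auto intro!: nn_integral_mono simp del: nn_integral_indicator)
  also have "\<dots> = ennreal (2 * \<epsilon>)" using assms by simp
  finally show ?thesis
    using assms by (simp add: measure_def enn2real_leI)
qed

lemma summable_exp_minus_powr:
  assumes "0 < b" "0 < \<delta>"
  shows "summable (\<lambda>m. exp (- (b * real m powr \<delta>)))"
proof -
  \<comment> \<open>Large enough that the \<open>n\<close>-th power of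
    \<open>m powr \<delta>\<close> dominates \<open>m^2\<close>; the lower bound
    \<open>(1 + x / n) ^ n\<close> of \<open>exp x\<close> then gives a summable majorant.\<close>
  define n where "n = nat \<lceil>2 / \<delta>\<rceil>"
  have "2 / \<delta> \<le> real n" unfolding n_def by linarith
  then have n: "2 \<le> \<delta> * n" using assms by (simp add: field_simps)
  then have n0: "n > 0" by (cases n) auto
  have "summable (\<lambda>m. inverse (real m ^ 2))" by (rule inverse_power_summable) simp
  then have "summable (\<lambda>m. (n / b) ^ n * inverse (real m ^ 2))" by (rule summable_mult)
  then show ?thesis
  proof (rule summable_comparison_test_ev[rotated], intro eventually_sequentiallyI[of 1])
    fix m :: nat assume m: "1 \<le> m"
    define x where "x = b * real m powr \<delta>"
    have x: "x > 0" using assms m by (simp add: x_def)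
    have "(x / n) ^ n \<le> (1 + x / n) ^ n" using x by (intro power_mono) auto
    also have "\<dots> \<le> exp x" using x n0 by (intro exp_ge_one_plus_x_over_n_power_n) auto
    finally have "exp (- x) \<le> inverse ((x / n) ^ n)"
      using x n0 by (simp add: exp_minus)
    also have "\<dots> = (n / b) ^ n * inverse ((real m powr \<delta>) ^ n)"
      using assms by (simp add: x_def field_simps)
    also have "(real m powr \<delta>) ^ n = real m powr (\<delta> * n)"
      using m powr_powr[of "real m" \<delta> "real n"] by (simp add: powr_realpow)
    also have "(n / b) ^ n * inverse (real m powr (\<delta> * n)) \<le> (n / b) ^ n * inverse (real m ^ 2)"
    proof (intro mult_left_mono le_imp_inverse_le)
      have "real m ^ 2 = real m powr 2" using m by simp
      also have "\<dots> \<le> real m powr (\<delta> * n)" using n m by (intro powr_mono) auto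
      finally show "real m ^ 2 \<le> real m powr (\<delta> * n)" .
    qed (use assms m in auto)
    finally show "norm (exp (- (b * real m powr \<delta>))) \<le> (n / b) ^ n * inverse (real m ^ 2)"
      by (simp add: x_def)
  qed
qed

subsection \<open>Almost sure convergence of averages\<close>

lemma C1_bounded_measurable: "C1_bounded L f f' \<Longrightarrow> f \<in> borel_measurable borel"
  unfolding C1_bounded_def
  by (intro borel_measurable_continuous_onI continuous_at_imp_continuous_on) (blast intro: DERIV_isCont)

text \<open>Borel-Cantelli for each of the countably many levels \<open>1 / (k + 1)\<close>, which
  share one exceptional null set.\<close>

lemma AE_LIMSEQ_0_of_summable_tails:
  fixes D :: "nat \<Rightarrow> 'a \<Rightarrow> real"
  assumes M: "prob_space M" and [measurable]: "\<And>m. D m \<in> borel_measurable M"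
    and sum: "\<And>e. 0 < e \<Longrightarrow> summable (\<lambda>m. measure M {\<omega> \<in> space M. e \<le> \<bar>D m \<omega>\<bar>})"
  shows "AE \<omega> in M. (\<lambda>m. D m \<omega>) \<longlonglongrightarrow> 0"
proof -
  interpret M: prob_space M by fact
  have "AE \<omega> in M. \<forall>k. eventually (\<lambda>m. \<omega> \<in> space M - {\<omega> \<in> space M. inverse (real (Suc k)) \<le> \<bar>D m \<omega>\<bar>}) sequentially"
    unfolding AE_all_countable
    by (intro allI borel_cantelli_AE1 sum) (auto simp: M.emeasure_eq_measure)
  then show ?thesis
  proof (rule AE_mp, intro AE_I2 impI)
    fix \<omega> assume \<omega>: "\<forall>k. eventually (\<lambda>m. \<omega> \<in> space M - {\<omega> \<in> space M. inverse (real (Suc k)) \<le> \<bar>D m \<omega>\<bar>}) sequentially"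
    show "(\<lambda>m. D m \<omega>) \<longlonglongrightarrow> 0"
    proof (rule tendstoI)
      fix e :: real assume "0 < e"
      then obtain k where "inverse (real (Suc k)) < e" using reals_Archimedean by blast
      with \<omega>[rule_format, of k] show "eventually (\<lambda>m. dist (D m \<omega>) 0 < e) sequentially"
        by (auto elim!: eventually_mono)
    qed
  qed
qed

text \<open>A deviation \<open>e\<close> of the average is a deviation \<open>e * m\<close> of the
  sum. The hypothesis on \<open>C\<close> bounds the variance proxy by a multiple of
  \<open>m powr (2 - \<delta>)\<close>, so the tail is at most
  \<open>2 * exp (- (b * m powr \<delta>))\<close>.\<close>

lemma gaussian_C1_average_AE:
  fixes w :: "nat \<Rightarrow> 'i \<Rightarrow> 'a \<Rightarrow> real" and f f' :: "nat \<Rightarrow> 'i \<Rightarrow> real \<Rightarrow> real"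
  assumes M: "prob_space M" and I: "\<And>m. finite (I m)"
    and G: "\<And>m. gaussian_family M (I m) (w m) (C m)"
    and C: "(\<lambda>m. (\<Sum>i\<in>I m. \<Sum>j\<in>I m. \<bar>C m i j\<bar>) / real m ^ 2) \<in> O(\<lambda>m. real m powr (- \<delta>))" and \<delta>: "0 < \<delta>"
    and f: "\<And>m i. i \<in> I m \<Longrightarrow> C1_bounded L (f m i) (f' m i)"
  shows "AE \<omega> in M. (\<lambda>m. ((\<Sum>i\<in>I m. f m i (w m i \<omega>)) - (\<integral>\<omega>'. (\<Sum>i\<in>I m. f m i (w m i \<omega>')) \<partial>M)) / real m) \<longlonglongrightarrow> 0"
proof (rule AE_LIMSEQ_0_of_summable_tails[OF M])
  interpret M: prob_space M by fact
  note [measurable] = gaussian_family_measurable[OF G]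
  have [measurable]: "f m i \<in> borel_measurable borel" if "i \<in> I m" for m i
    using f[OF that] by (rule C1_bounded_measurable)
  show "(\<lambda>\<omega>. ((\<Sum>i\<in>I m. f m i (w m i \<omega>)) - (\<integral>\<omega>'. (\<Sum>i\<in>I m. f m i (w m i \<omega>')) \<partial>M)) / real m) \<in> borel_measurable M" for m
    by measurable
  define D where "D = (\<lambda>m \<omega>. (\<Sum>i\<in>I m. f m i (w m i \<omega>)) - (\<integral>\<omega>'. (\<Sum>i\<in>I m. f m i (w m i \<omega>')) \<partial>M))"
  fix e :: real assume e: "0 < e"
  obtain c where c: "0 < c" and ev: "eventually (\<lambda>m. norm ((\<Sum>i\<in>I m. \<Sum>j\<in>I m. \<bar>C m i j\<bar>) / real m ^ 2) \<le> c * norm (real m powr (- \<delta>))) sequentially"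
    using C by (elim landau_o.bigE)
  \<comment> \<open>The summand 1 keeps \<open>K\<close> positive when \<open>L = 0\<close>.\<close>
  define K where "K = (L\<^sup>2 + 1) * c"
  have K: "0 < K" using c by (auto simp: K_def intro!: mult_pos_pos add_nonneg_pos)
  define b where "b = 2 * e\<^sup>2 / (pi\<^sup>2 * K)"
  have b: "0 < b" using e K by (simp add: b_def)
  have "summable (\<lambda>m. 2 * exp (- (b * real m powr \<delta>)))"
    by (intro summable_mult summable_exp_minus_powr b \<delta>)
  then show "summable (\<lambda>m. measure M {\<omega> \<in> space M. e \<le> \<bar>D m \<omega> / real m\<bar>})"
  proof (rule summable_comparison_test_ev[rotated])
    show "eventually (\<lambda>m. norm (measure M {\<omega> \<in> space M. e \<le> \<bar>D m \<omega> / real m\<bar>}) \<le> 2 * exp (- (b * real m powr \<delta>))) sequentially"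
      using ev eventually_gt_at_top[of 0]
    proof eventually_elim
      case (elim m)
      define S where "S = (\<Sum>i\<in>I m. \<Sum>j\<in>I m. \<bar>C m i j\<bar>)"
      have S0: "0 \<le> S" unfolding S_def by (intro sum_nonneg) auto
      have "S / real m ^ 2 \<le> c * real m powr (- \<delta>)"
        using elim S0 by (simp add: S_def)
      then have S: "S \<le> c * real m powr (- \<delta>) * real m ^ 2"
        using elim by (simp add: divide_le_eq)
      have KS: "L\<^sup>2 * S \<le> K * real m powr (- \<delta>) * real m ^ 2"
      proof -
        have "L\<^sup>2 * S \<le> (L\<^sup>2 + 1) * (c * real m powr (- \<delta>) * real m ^ 2)"
          by (intro mult_mono S) (use S0 in auto)
        then show ?thesis by (simp add: K_def mult_ac)
      qed
      have "measure M {\<omega> \<in> space M. e \<le> \<bar>D m \<omega> / real m\<bar>} = measure M {\<omega> \<in> space M. e * real m \<le> \<bar>D m \<omega>\<bar>}"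
        using elim by (simp add: pos_le_divide_eq)
      also have "\<dots> \<le> 2 * exp (- (2 * (e * real m)\<^sup>2 / (pi\<^sup>2 * (K * real m powr (- \<delta>) * real m ^ 2))))"
        unfolding D_def
        by (rule gaussian_concentration[OF M I G, where f' = "f' m" and B = 1])
          (use f KS K e elim in \<open>auto simp: C1_bounded_def S_def\<close>)
      also have "2 * (e * real m)\<^sup>2 / (pi\<^sup>2 * (K * real m powr (- \<delta>) * real m ^ 2)) = b * real m powr \<delta>"
        using elim K by (simp add: b_def powr_minus field_simps)
      finally show ?case by simp
    qed
  qed
qed

text \<open>Replacing each indicator by its smooth majorant or minorant changes its mean by at most
  \<open>2 * e\<close>, and the smooth averages converge by
  \<open>gaussian_C1_average_AE\<close>.\<close>

lemma gaussian_threshold_average_AE: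
  fixes w :: "nat \<Rightarrow> nat \<Rightarrow> 'a \<Rightarrow> real"
  assumes M: "prob_space M" and I: "\<And>m. I m \<subseteq> {1..m}"
    and G: "\<And>m. gaussian_family M (I m) (w m) (C m)"
    and var: "\<And>m i. i \<in> I m \<Longrightarrow> C m i i = 1"
    and C: "(\<lambda>m. (\<Sum>i\<in>I m. \<Sum>j\<in>I m. \<bar>C m i j\<bar>) / real m ^ 2) \<in> O(\<lambda>m. real m powr (- \<delta>))" and \<delta>: "0 < \<delta>"
    and U: "\<And>m i x y. i \<in> I m \<Longrightarrow> x \<in> U m i \<Longrightarrow> x \<le> y \<Longrightarrow> y \<in> U m i"
    and U_borel: "\<And>m i. i \<in> I m \<Longrightarrow> U m i \<in> sets borel"
  shows "AE \<omega> in M. (\<lambda>m. (\<Sum>i\<in>I m. indicator (U m i) (w m i \<omega>) -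
      (\<integral>\<omega>'. indicator (U m i) (w m i \<omega>') \<partial>M)) / real m) \<longlonglongrightarrow> 0"
proof -
  interpret M: prob_space M by fact
  have fin: "finite (I m)" for m using I finite_subset by blast
  note [measurable] = gaussian_family_measurable[OF G] U_borel
  define T where "T = (\<lambda>m \<omega>. (\<Sum>i\<in>I m. indicator (U m i) (w m i \<omega>) -
      (\<integral>\<omega>'. indicator (U m i) (w m i \<omega>') \<partial>M)) / real m)"
  \<comment> \<open>One \<open>e\<close> is the eventual deviation of the smooth averages, the other
    two bound the change of the means.\<close>
  have small: "AE \<omega> in M. eventually (\<lambda>m. \<bar>T m \<omega>\<bar> \<le> 3 * e) sequentially" if e: "0 < e" for e
  proof -
    \<comment> \<open>The condition \<open>i \<in> I m\<close> stands inside the existential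
      quantifiers so that the axiom of choice yields functions of all \<open>m\<close> and
      \<open>i\<close>.\<close>
    have "\<forall>m i. \<exists>f f' g g' a. i \<in> I m \<longrightarrow> C1_bounded (2 / e) f f' \<and> C1_bounded (2 / e) g g' \<and>
      (\<forall>x. f x \<le> indicator (U m i) x \<and> indicator (U m i) x \<le> g x \<and> g x - f x \<le> indicator {a - e..a + e} x)"
    proof (intro allI)
      fix m i
      show "\<exists>f f' g g' a. i \<in> I m \<longrightarrow> C1_bounded (2 / e) f f' \<and> C1_bounded (2 / e) g g' \<and>
        (\<forall>x. f x \<le> indicator (U m i) x \<and> indicator (U m i) x \<le> g x \<and> g x - f x \<le> indicator {a - e..a + e} x)"
      proof (cases "i \<in> I m")
        case True
        have "y \<in> U m i" if "x \<in> U m i" "x \<le> y" for x y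
          using U[OF True that] .
        from upper_set_smooth_sandwich[OF this e] show ?thesis by simp
      qed simp
    qed
    then obtain f f' g g' a where sandwich: "\<And>m i. i \<in> I m \<Longrightarrow> C1_bounded (2 / e) (f m i) (f' m i) \<and>
        C1_bounded (2 / e) (g m i) (g' m i) \<and>
        (\<forall>x. f m i x \<le> indicator (U m i) x \<and> indicator (U m i) x \<le> g m i x \<and>
          g m i x - f m i x \<le> indicator {a m i - e..a m i + e} x)"
      by (simp only: choice_iff) blast
    have [measurable]: "f m i \<in> borel_measurable borel" "g m i \<in> borel_measurable borel" if "i \<in> I m" for m i
      using sandwich[OF that] by (blast intro: C1_bounded_measurable)+
    have intf: "integrable M (\<lambda>\<omega>. f m i (w m i \<omega>))" and intg: "integrable M (\<lambda>\<omega>. g m i (w m i \<omega>))"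
      and intU: "integrable M (\<lambda>\<omega>. indicator (U m i) (w m i \<omega>) :: real)" if "i \<in> I m" for m i
      using sandwich[OF that] that
      by (auto intro!: M.integrable_const_bound[of _ 1] simp: C1_bounded_def indicator_def)
    \<comment> \<open>The difference of the two smooth functions is at most the indicator of an
      interval of length \<open>2 * e\<close>, evaluated at a standard normal variable.\<close>
    have gap: "(\<integral>\<omega>. g m i (w m i \<omega>) \<partial>M) - (\<integral>\<omega>. f m i (w m i \<omega>) \<partial>M) \<le> 2 * e" if i: "i \<in> I m" for m i
    proof -
      have "(\<integral>\<omega>. g m i (w m i \<omega>) \<partial>M) - (\<integral>\<omega>. f m i (w m i \<omega>) \<partial>M) =
          (\<integral>\<omega>. g m i (w m i \<omega>) - f m i (w m i \<omega>) \<partial>M)"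
        using intf[OF i] intg[OF i] by simp
      also have "\<dots> \<le> (\<integral>\<omega>. indicator {a m i - e..a m i + e} (w m i \<omega>) \<partial>M)"
        by (rule integral_mono)
          (use sandwich[OF i] intf[OF i] intg[OF i] i in
            \<open>auto intro!: M.integrable_const_bound[of _ 1] simp: indicator_def\<close>)
      also have "\<dots> = (\<integral>x. indicator {a m i - e..a m i + e} x \<partial>distr M borel (w m i))"
        using i by (subst integral_distr) auto
      also have "\<dots> = measure std_normal_distribution {a m i - e..a m i + e}"
        unfolding gaussian_family_std_normal[OF G fin i var[OF i]] by simp
      also have "\<dots> \<le> 2 * e" using e by (intro std_normal_interval_le) simp
      finally show ?thesis .
    qed
    define F where "F = (\<lambda>m \<omega>. ((\<Sum>i\<in>I m. f m i (w m i \<omega>)) - (\<integral>\<omega>'. (\<Sum>i\<in>I m. f m i (w m i \<omega>')) \<partial>M)) / real m)"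
    define H where "H = (\<lambda>m \<omega>. ((\<Sum>i\<in>I m. g m i (w m i \<omega>)) - (\<integral>\<omega>'. (\<Sum>i\<in>I m. g m i (w m i \<omega>')) \<partial>M)) / real m)"
    have F_eq: "F m \<omega> = (\<Sum>i\<in>I m. f m i (w m i \<omega>) - (\<integral>\<omega>'. f m i (w m i \<omega>') \<partial>M)) / real m"
      and H_eq: "H m \<omega> = (\<Sum>i\<in>I m. g m i (w m i \<omega>) - (\<integral>\<omega>'. g m i (w m i \<omega>') \<partial>M)) / real m" for m \<omega>
      unfolding F_def H_def by (simp_all add: Bochner_Integration.integral_sum intf intg sum_subtractf)
    have FH: "AE \<omega> in M. (\<lambda>m. F m \<omega>) \<longlonglongrightarrow> 0" "AE \<omega> in M. (\<lambda>m. H m \<omega>) \<longlonglongrightarrow> 0"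
      unfolding F_def H_def
      by (rule gaussian_C1_average_AE[OF M fin G C \<delta>]; use sandwich in blast)+
    have card: "real (card (I m)) * (2 * e) / real m \<le> 2 * e" if "0 < m" for m
    proof -
      have "card (I m) \<le> m" using card_mono[OF _ I[of m]] by simp
      then show ?thesis using e that by (simp add: field_simps)
    qed
    have upper: "T m \<omega> \<le> H m \<omega> + 2 * e" if m: "0 < m" for m \<omega>
    proof -
      have "(\<Sum>i\<in>I m. indicator (U m i) (w m i \<omega>) - (\<integral>\<omega>'. indicator (U m i) (w m i \<omega>') \<partial>M)) \<le>
          (\<Sum>i\<in>I m. (g m i (w m i \<omega>) - (\<integral>\<omega>'. g m i (w m i \<omega>') \<partial>M)) + 2 * e)"
      proof (rule sum_mono)
        fix i assume i: "i \<in> I m"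
        have "(\<integral>\<omega>'. f m i (w m i \<omega>') \<partial>M) \<le> (\<integral>\<omega>'. indicator (U m i) (w m i \<omega>') \<partial>M)"
          by (rule integral_mono[OF intf[OF i] intU[OF i]]) (use sandwich[OF i] in auto)
        moreover have "indicator (U m i) (w m i \<omega>) \<le> g m i (w m i \<omega>)" using sandwich[OF i] by auto
        ultimately show "indicator (U m i) (w m i \<omega>) - (\<integral>\<omega>'. indicator (U m i) (w m i \<omega>') \<partial>M) \<le>
            (g m i (w m i \<omega>) - (\<integral>\<omega>'. g m i (w m i \<omega>') \<partial>M)) + 2 * e"
          using gap[OF i] by linarith
      qed
      then have "T m \<omega> \<le> (\<Sum>i\<in>I m. (g m i (w m i \<omega>) - (\<integral>\<omega>'. g m i (w m i \<omega>') \<partial>M)) + 2 * e) / real m"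
        unfolding T_def by (rule divide_right_mono) simp
      also have "\<dots> = H m \<omega> + real (card (I m)) * (2 * e) / real m"
        by (simp add: H_eq sum.distrib add_divide_distrib)
      finally show ?thesis using card[OF m] by simp
    qed
    have lower: "F m \<omega> - 2 * e \<le> T m \<omega>" if m: "0 < m" for m \<omega>
    proof -
      have "(\<Sum>i\<in>I m. (f m i (w m i \<omega>) - (\<integral>\<omega>'. f m i (w m i \<omega>') \<partial>M)) - 2 * e) \<le>
          (\<Sum>i\<in>I m. indicator (U m i) (w m i \<omega>) - (\<integral>\<omega>'. indicator (U m i) (w m i \<omega>') \<partial>M))"
      proof (rule sum_mono)
        fix i assume i: "i \<in> I m"
        have "(\<integral>\<omega>'. indicator (U m i) (w m i \<omega>') \<partial>M) \<le> (\<integral>\<omega>'. g m i (w m i \<omega>') \<partial>M)"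
          by (rule integral_mono[OF intU[OF i] intg[OF i]]) (use sandwich[OF i] in auto)
        moreover have "f m i (w m i \<omega>) \<le> indicator (U m i) (w m i \<omega>)" using sandwich[OF i] by auto
        ultimately show "(f m i (w m i \<omega>) - (\<integral>\<omega>'. f m i (w m i \<omega>') \<partial>M)) - 2 * e \<le>
            indicator (U m i) (w m i \<omega>) - (\<integral>\<omega>'. indicator (U m i) (w m i \<omega>') \<partial>M)"
          using gap[OF i] by linarith
      qed
      then have "(\<Sum>i\<in>I m. (f m i (w m i \<omega>) - (\<integral>\<omega>'. f m i (w m i \<omega>') \<partial>M)) - 2 * e) / real m \<le> T m \<omega>"
        unfolding T_def by (rule divide_right_mono) simp
      also have "(\<Sum>i\<in>I m. (f m i (w m i \<omega>) - (\<integral>\<omega>'. f m i (w m i \<omega>') \<partial>M)) - 2 * e) / real m =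
          F m \<omega> - real (card (I m)) * (2 * e) / real m"
        by (simp add: F_eq sum_subtractf diff_divide_distrib)
      finally show ?thesis using card[OF m] by simp
    qed
    from FH show ?thesis
    proof eventually_elim
      case (elim \<omega>)
      have "eventually (\<lambda>m. dist (F m \<omega>) 0 < e) sequentially" "eventually (\<lambda>m. dist (H m \<omega>) 0 < e) sequentially"
        by (fact tendstoD[OF elim(1) e] tendstoD[OF elim(2) e])+
      then show ?case
        using eventually_gt_at_top[of 0]
      proof eventually_elim
        case (elim m)
        then show ?case using upper[of m \<omega>] lower[of m \<omega>] by simp
      qed
    qed
  qed
  have "AE \<omega> in M. \<forall>k. eventually (\<lambda>m. \<bar>T m \<omega>\<bar> \<le> 3 * inverse (real (Suc k))) sequentially"
    unfolding AE_all_countable by (intro allI small) simp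
  then have "AE \<omega> in M. (\<lambda>m. T m \<omega>) \<longlonglongrightarrow> 0"
  proof (rule AE_mp, intro AE_I2 impI)
    fix \<omega> assume \<omega>: "\<forall>k. eventually (\<lambda>m. \<bar>T m \<omega>\<bar> \<le> 3 * inverse (real (Suc k))) sequentially"
    show "(\<lambda>m. T m \<omega>) \<longlonglongrightarrow> 0"
    proof (rule tendstoI)
      fix e :: real assume "0 < e"
      then obtain k where k: "inverse (real (Suc k)) < e / 3" using reals_Archimedean[of "e / 3"] by auto
      show "eventually (\<lambda>m. dist (T m \<omega>) 0 < e) sequentially"
        using \<omega>[rule_format, of k] by eventually_elim (use k in simp)
    qed
  qed
  then show ?thesis unfolding T_def .
qed

subsection \<open>Normal vectors with correlations\<close>

text \<open>The moments are those of the standard normal law scaled by \<open>sqrt c\<close>, which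
  covers \<open>c = 0\<close> as well.\<close>

lemma normal_law_moments:
  assumes Y[measurable]: "Y \<in> borel_measurable M" and D: "distr M borel Y = normal_law 0 c" and c: "0 \<le> c"
  shows "integrable M (\<lambda>\<omega>. (Y \<omega>)\<^sup>2)" "(\<integral>\<omega>. Y \<omega> \<partial>M) = 0" "(\<integral>\<omega>. (Y \<omega>)\<^sup>2 \<partial>M) = c"
proof -
  note D' = D[unfolded normal_law_eq_distr[OF c]]
  have "integrable (distr std_normal_distribution borel (\<lambda>x. sqrt c * x)) (\<lambda>y. y\<^sup>2)"
    using integrable_std_normal_distribution_moment[of 2] c
    by (subst integrable_distr_eq) (auto simp: power_mult_distrib)
  then have "integrable (distr M borel Y) (\<lambda>y. y\<^sup>2)" by (simp add: D')
  then show "integrable M (\<lambda>\<omega>. (Y \<omega>)\<^sup>2)" by (subst (asm) integrable_distr_eq) auto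
  have "(\<integral>\<omega>. Y \<omega> \<partial>M) = (\<integral>y. y \<partial>distr M borel Y)" by (subst integral_distr) auto
  also have "\<dots> = sqrt c * (\<integral>x. x \<partial>std_normal_distribution)"
    unfolding D' by (subst integral_distr) auto
  also have "(\<integral>x. x \<partial>std_normal_distribution) = 0"
    using integral_std_normal_distribution_moment_odd[of 1] by simp
  finally show "(\<integral>\<omega>. Y \<omega> \<partial>M) = 0" by simp
  have "(\<integral>\<omega>. (Y \<omega>)\<^sup>2 \<partial>M) = (\<integral>y. y\<^sup>2 \<partial>distr M borel Y)" by (subst integral_distr) auto
  also have "\<dots> = c * (\<integral>x. x\<^sup>2 \<partial>std_normal_distribution)"
    unfolding D' using c by (subst integral_distr) (auto simp: power_mult_distrib)
  also have "(\<integral>x. x\<^sup>2 \<partial>std_normal_distribution) = 1"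
    using std_normal_distribution_even_moments[of 1] by simp
  finally show "(\<integral>\<omega>. (Y \<omega>)\<^sup>2 \<partial>M) = c" by simp
qed

lemma mv_normal_gaussian_family:
  "mv_normal M m X (\<lambda>_. 0) C \<Longrightarrow> gaussian_family M {1..m} X C"
  by (simp add: mv_normal_def gaussian_family_def quad_form_def)

text \<open>A combination over \<open>J\<close> of rescaled components is one over \<open>I\<close>
  with coefficients \<open>u i * s i\<close> on \<open>J\<close> and 0 elsewhere. Dropping and
  rescaling components is thus a single substitution.\<close>

lemma gaussian_family_scale:
  assumes G: "gaussian_family M I X C" and J: "J \<subseteq> I" "finite I"
  shows "gaussian_family M J (\<lambda>i \<omega>. s i * X i \<omega>) (\<lambda>i j. s i * C i j * s j)"
proof -
  have ext: "(\<Sum>i\<in>J. h i) = (\<Sum>i\<in>I. if i \<in> J then h i else 0)" for h :: "_ \<Rightarrow> real"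
    using J by (simp add: sum.inter_restrict[symmetric] Int_absorb1)
  have lin: "(\<Sum>i\<in>J. u i * (s i * X i \<omega>)) = (\<Sum>i\<in>I. (if i \<in> J then u i * s i else 0) * X i \<omega>)" for u \<omega>
    unfolding ext by (intro sum.cong) auto
  have quad: "quad_form J (\<lambda>i j. s i * C i j * s j) u = quad_form I C (\<lambda>i. if i \<in> J then u i * s i else 0)" for u
    unfolding quad_form_def ext by (intro sum.cong refl) (auto intro!: sum.cong simp: mult_ac)
  have "(\<lambda>\<omega>. s i * X i \<omega>) \<in> borel_measurable M" if "i \<in> J" for i
    using gaussian_family_measurable[OF G, of i] that J by auto
  then show ?thesis
    using G unfolding gaussian_family_def lin quad
    by (intro conjI ballI allI) simp_all
qed

text \<open>Polarization: the second moments of \<open>X i\<close>, \<open>X j\<close> and their sum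
  are known from the one-dimensional laws. This links the matrix of the family to the correlations
  in the hypothesis.\<close>

lemma gaussian_family_covariance:
  fixes X :: "'i \<Rightarrow> 'a \<Rightarrow> real"
  assumes M: "prob_space M" and G: "gaussian_family M I X C" and I: "finite I" "i \<in> I" "j \<in> I"
    and sym: "C i j = C j i"
  shows "covariance M (X i) (X j) = C i j"
proof -
  interpret M: prob_space M by fact
  note [measurable] = gaussian_family_measurable[OF G]
  define e where "e = (\<lambda>(k :: 'i) l. if l = k then 1 else 0 :: real)"
  have lin: "(\<Sum>l\<in>I. e k l * h l) = h k" "(\<Sum>l\<in>I. h l * e k l) = h k" if "k \<in> I" for k h
    using that I(1) by (simp_all add: e_def if_distrib[of "\<lambda>x. x * _"] if_distrib[of "\<lambda>x. _ * x"] cong: if_cong)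
  have mom: "integrable M (\<lambda>\<omega>. (\<Sum>k\<in>I. u k * X k \<omega>)\<^sup>2)" "(\<integral>\<omega>. (\<Sum>k\<in>I. u k * X k \<omega>) \<partial>M) = 0"
    "(\<integral>\<omega>. (\<Sum>k\<in>I. u k * X k \<omega>)\<^sup>2 \<partial>M) = quad_form I C u" for u
    using G by (intro normal_law_moments[where c = "quad_form I C u"]; force simp: gaussian_family_def)+
  have quad: "quad_form I C (e k) = C k k" if "k \<in> I" for k
    using that by (simp add: quad_form_def mult.assoc sum_distrib_left[symmetric] lin)
  have quad2: "quad_form I C (\<lambda>l. e i l + e j l) = C i i + C i j + C j i + C j j"
    using I by (simp add: quad_form_def distrib_left distrib_right sum.distrib mult.assoc sum_distrib_left[symmetric] lin)
  have int: "integrable M (\<lambda>\<omega>. (X k \<omega>)\<^sup>2)" and mean: "(\<integral>\<omega>. X k \<omega> \<partial>M) = 0"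
    and var: "(\<integral>\<omega>. (X k \<omega>)\<^sup>2 \<partial>M) = C k k" if "k \<in> I" for k
    using mom[of "e k"] that by (simp_all add: lin quad)
  have X2: "integrable M (\<lambda>\<omega>. (X i \<omega> + X j \<omega>)\<^sup>2)" "(\<integral>\<omega>. (X i \<omega> + X j \<omega>)\<^sup>2 \<partial>M) = C i i + 2 * C i j + C j j"
    using mom(1,3)[of "\<lambda>l. e i l + e j l"] I sym
    by (simp_all add: distrib_right sum.distrib lin quad2)
  have "covariance M (X i) (X j) = (\<integral>\<omega>. ((X i \<omega> + X j \<omega>)\<^sup>2 - (X i \<omega>)\<^sup>2 - (X j \<omega>)\<^sup>2) / 2 \<partial>M)"
    unfolding covariance_def using I
    by (intro Bochner_Integration.integral_cong refl) (simp add: mean power2_sum)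
  also have "\<dots> = C i j"
    using int X2 I by (simp add: var)
  finally show ?thesis .
qed

lemma mv_normal_std_dev:
  assumes "prob_space M" "mv_normal M m X (\<lambda>_. 0) C" "i \<in> {1..m}"
  shows "(std_dev M (X i))\<^sup>2 = C i i"
proof -
  have "C i i = prob_space.variance M (X i)"
    using gaussian_family_covariance[OF assms(1) mv_normal_gaussian_family[OF assms(2)], of i i] assms(3)
    by (simp add: covariance_def power2_eq_square)
  then show ?thesis
    using mv_normal_component(2)[OF assms(2,3)] by (simp add: std_dev_def)
qed

lemma mv_normal_degenerate:
  assumes "prob_space M" "mv_normal M m X (\<lambda>_. 0) C" "i \<in> {1..m}" "std_dev M (X i) = 0"
  shows "AE \<omega> in M. X i \<omega> = 0"
proof -
  have [measurable]: "X i \<in> borel_measurable M" using assms by (auto simp: mv_normal_def)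
  have d: "distr M borel (X i) = return borel 0"
    using mv_normal_component(1)[OF assms(2,3)] mv_normal_std_dev[OF assms(1-3)] assms(4)
    by (simp add: normal_law_def)
  have "AE x in distr M borel (X i). x = 0"
    unfolding d by (subst AE_return) auto
  then show ?thesis by (subst (asm) AE_distr_iff) auto
qed

text \<open>Components with nonzero standard deviation are standardized and treated by
  \<open>gaussian_threshold_average_AE\<close>; the others are almost surely 0, so their indicators
  almost surely equal their means.\<close>

lemma mv_normal_upper_set_average_AE:
  fixes v :: "nat \<Rightarrow> nat \<Rightarrow> 'a \<Rightarrow> real"
  assumes M: "prob_space M" and v: "\<And>m. 1 \<le> m \<Longrightarrow> mv_normal M m (v m) (\<lambda>_. 0) (\<Sigma> m)"
    and C: "(\<lambda>m. matrix_norm1 m (\<lambda>i j. correlation M (v m i) (v m j)) / real m ^ 2)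
           \<in> O(\<lambda>m. real m powr (- \<delta>))" and \<delta>: "0 < \<delta>"
    and J: "\<And>m. J m \<subseteq> {1..m}"
    and U: "\<And>m i x y. i \<in> J m \<Longrightarrow> x \<in> U m i \<Longrightarrow> x \<le> y \<Longrightarrow> y \<in> U m i"
    and U_borel: "\<And>m i. i \<in> J m \<Longrightarrow> U m i \<in> sets borel"
  shows "AE \<omega> in M. (\<lambda>m. (\<Sum>i\<in>J m. indicator (U m i) (v m i \<omega>) -
      (\<integral>\<omega>'. indicator (U m i) (v m i \<omega>') \<partial>M)) / real m) \<longlonglongrightarrow> 0"
proof -
  interpret M: prob_space M by fact
  define sd where "sd = (\<lambda>m i. std_dev M (v m i))"
  define I where "I = (\<lambda>m. {i \<in> J m. sd m i \<noteq> 0})"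
  have IJ: "I m \<subseteq> J m" for m by (auto simp: I_def)
  have I: "I m \<subseteq> {1..m}" for m using IJ J by blast
  have fin: "finite (J m)" for m using J finite_subset by blast
  \<comment> \<open>In dimension 0, which \<open>v\<close> does not cover, the empty family has the
    zero sum as its only combination.\<close>
  have vG: "gaussian_family M {1..m} (v m) (\<Sigma> m)" for m
  proof (cases "m = 0")
    case True
    then show ?thesis
      by (simp add: gaussian_family_def quad_form_def normal_law_def M.distr_const)
  next
    case False
    then show ?thesis by (intro mv_normal_gaussian_family v) simp
  qed
  have meas[measurable]: "v m i \<in> borel_measurable M" if "i \<in> J m" for m i
    using gaussian_family_measurable[OF vG[of m], of i] J[of m] that by blast
  have J1: "1 \<le> m" if "i \<in> J m" for m i using J[of m] that by auto
  have sd_pos: "0 < sd m i" if "i \<in> I m" for m i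
    using that M.variance_positive[of "v m i"] by (simp add: I_def sd_def std_dev_def less_le)
  define w where "w = (\<lambda>m i \<omega>. inverse (sd m i) * v m i \<omega>)"
  define R where "R = (\<lambda>m i j. inverse (sd m i) * \<Sigma> m i j * inverse (sd m j))"
  have R_eq: "R m i j = correlation M (v m i) (v m j)" if "i \<in> I m" "j \<in> I m" for m i j
  proof -
    have ij: "i \<in> {1..m}" "j \<in> {1..m}" using that I by blast+
    \<comment> \<open>Polarization only yields the sum of the two mirrored entries, hence the appeal
      to the symmetry contained in \<open>mv_normal\<close>.\<close>
    then have "\<Sigma> m i j = \<Sigma> m j i" using v[of m] by (auto simp: mv_normal_def)
    then have "covariance M (v m i) (v m j) = \<Sigma> m i j"
      using ij by (intro gaussian_family_covariance[OF M vG]) auto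
    then show ?thesis by (simp add: R_def correlation_def sd_def field_simps)
  qed
  \<comment> \<open>The upper sets on the standardized scale; they remain upper sets because the
    scaling factor is positive.\<close>
  define U' where "U' = (\<lambda>m i. {x. sd m i * x \<in> U m i})"
  have "AE \<omega> in M. (\<lambda>m. (\<Sum>i\<in>I m. indicator (U' m i) (w m i \<omega>) -
      (\<integral>\<omega>'. indicator (U' m i) (w m i \<omega>') \<partial>M)) / real m) \<longlonglongrightarrow> 0"
  proof (rule gaussian_threshold_average_AE[OF M I, where C = R and \<delta> = \<delta>])
    show "gaussian_family M (I m) (w m) (R m)" for m
      unfolding w_def R_def by (rule gaussian_family_scale[OF vG I]) simp
    show "R m i i = 1" if "i \<in> I m" for m i
      using mv_normal_std_dev[OF M v, of m i] sd_pos[OF that] that I[of m] J1 IJ[of m]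
      by (auto simp: R_def sd_def power2_eq_square field_simps)
    have "(\<lambda>m. (\<Sum>i\<in>I m. \<Sum>j\<in>I m. \<bar>R m i j\<bar>) / real m ^ 2) \<in>
        O(\<lambda>m. matrix_norm1 m (\<lambda>i j. correlation M (v m i) (v m j)) / real m ^ 2)"
    proof (rule landau_o.big_mono, rule always_eventually, rule allI)
      fix m
      have "(\<Sum>i\<in>I m. \<Sum>j\<in>I m. \<bar>R m i j\<bar>) = (\<Sum>i\<in>I m. \<Sum>j\<in>I m. \<bar>correlation M (v m i) (v m j)\<bar>)"
        by (intro sum.cong refl) (simp add: R_eq)
      also have "\<dots> \<le> (\<Sum>i\<in>I m. \<Sum>j=1..m. \<bar>correlation M (v m i) (v m j)\<bar>)"
        by (intro sum_mono sum_mono2 I) auto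
      also have "\<dots> \<le> matrix_norm1 m (\<lambda>i j. correlation M (v m i) (v m j))"
        unfolding matrix_norm1_def by (intro sum_mono2 I sum_nonneg) auto
      finally show "norm ((\<Sum>i\<in>I m. \<Sum>j\<in>I m. \<bar>R m i j\<bar>) / real m ^ 2) \<le>
          norm (matrix_norm1 m (\<lambda>i j. correlation M (v m i) (v m j)) / real m ^ 2)"
        by (simp add: sum_nonneg divide_right_mono abs_of_nonneg)
    qed
    then show "(\<lambda>m. (\<Sum>i\<in>I m. \<Sum>j\<in>I m. \<bar>R m i j\<bar>) / real m ^ 2) \<in> O(\<lambda>m. real m powr - \<delta>)"
      using C by (rule landau_o.big_trans)
    show "y \<in> U' m i" if "i \<in> I m" "x \<in> U' m i" "x \<le> y" for m i x y
      using U[of i m "sd m i * x" "sd m i * y"] that sd_pos[of i m] IJ by (auto simp: U'_def)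
    show "U' m i \<in> sets borel" if "i \<in> I m" for m i
    proof -
      have [measurable]: "U m i \<in> sets borel" using that IJ by (intro U_borel) auto
      show ?thesis unfolding U'_def by measurable
    qed
  qed (use \<delta> in simp)
  moreover have "indicator (U' m i) (w m i \<omega>) = (indicator (U m i) (v m i \<omega>) :: real)" if "i \<in> I m" for m i \<omega>
    using sd_pos[OF that] by (simp add: U'_def w_def indicator_def field_simps)
  ultimately have main: "AE \<omega> in M. (\<lambda>m. (\<Sum>i\<in>I m. indicator (U m i) (v m i \<omega>) -
      (\<integral>\<omega>'. indicator (U m i) (v m i \<omega>') \<partial>M)) / real m) \<longlonglongrightarrow> 0"
    by (simp cong: sum.cong)
  have deg: "AE \<omega> in M. indicator (U m i) (v m i \<omega>) - (\<integral>\<omega>'. indicator (U m i) (v m i \<omega>') \<partial>M) = (0 :: real)"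
    if i: "i \<in> J m - I m" for m i
  proof -
    have 0: "AE \<omega> in M. v m i \<omega> = 0"
      using i J[of m] J1[of i m] by (intro mv_normal_degenerate[OF M v]) (auto simp: I_def sd_def)
    have [measurable]: "U m i \<in> sets borel" "v m i \<in> borel_measurable M"
      using i by (auto intro!: U_borel meas)
    have "(\<integral>\<omega>'. indicator (U m i) (v m i \<omega>') \<partial>M) = (\<integral>\<omega>'. indicator (U m i) 0 \<partial>M :: real)"
      by (rule integral_cong_AE) (use 0 in auto)
    with 0 show ?thesis by (auto simp: M.prob_space)
  qed
  \<comment> \<open>Countably many dimensions with finitely many degenerate components each leave
    one null set.\<close>
  have "AE \<omega> in M. \<forall>m. \<forall>i\<in>J m - I m. indicator (U m i) (v m i \<omega>) - (\<integral>\<omega>'. indicator (U m i) (v m i \<omega>') \<partial>M) = (0 :: real)"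
    unfolding AE_all_countable using fin deg by (auto intro!: AE_finite_allI)
  with main show ?thesis
  proof eventually_elim
    case (elim \<omega>)
    have "(\<Sum>i\<in>J m. indicator (U m i) (v m i \<omega>) - (\<integral>\<omega>'. indicator (U m i) (v m i \<omega>') \<partial>M)) =
        (\<Sum>i\<in>I m. indicator (U m i) (v m i \<omega>) - (\<integral>\<omega>'. indicator (U m i) (v m i \<omega>') \<partial>M) :: real)" for m
      using elim(2) by (intro sum.mono_neutral_right fin IJ) auto
    with elim(1) show ?case by simp
  qed
qed

subsection \<open>Rejections\<close>

lemma null_cdf_mono:
  assumes M: "prob_space M" and v: "v i \<in> borel_measurable M" and "x \<le> y"
  shows "null_cdf M v i x \<le> null_cdf M v i y"
proof -
  interpret M: prob_space M by fact
  interpret real_distribution "distr M borel (v i)" using v by (rule M.real_distribution_distr)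
  show ?thesis unfolding null_cdf_def by (rule cdf_nondecreasing) fact
qed

lemma null_cdf_measurable:
  assumes "prob_space M" "v i \<in> borel_measurable M"
  shows "null_cdf M v i \<in> borel_measurable borel"
  by (intro borel_measurable_mono monoI null_cdf_mono assms)

text \<open>A one-sided rejection region is itself an upper set, and \<open>V = UNIV\<close>
  contributes nothing. A two-sided one consists of an upper set \<open>U\<close> and a lower set,
  the latter entering through its complement \<open>V\<close>.\<close>

lemma rejected_decompose:
  assumes F: "\<And>x y. x \<le> y \<Longrightarrow> F i x \<le> F i y" and [measurable]: "F i \<in> borel_measurable borel"
  obtains U V where "\<And>x y. x \<in> U \<Longrightarrow> x \<le> y \<Longrightarrow> y \<in> U" "\<And>x y. x \<in> V \<Longrightarrow> x \<le> y \<Longrightarrow> y \<in> V"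
    "U \<in> sets borel" "V \<in> sets borel"
    "\<And>z h. rejected s F t z h i = indicator U (z i - h i) + 1 - indicator V (z i - h i)"
proof (cases s)
  case One_Sided
  show thesis
  proof (rule that[of "{x. 1 - F i x \<le> t}" UNIV])
    show "\<And>x y. x \<in> {x. 1 - F i x \<le> t} \<Longrightarrow> x \<le> y \<Longrightarrow> y \<in> {x. 1 - F i x \<le> t}"
      using F by fastforce
  qed (auto simp: rejected_def adj_pval_def One_Sided indicator_def)
next
  case Two_Sided
  \<comment> \<open>The point 0 is assigned to \<open>U\<close> alone, so that the two pieces are
    disjoint and their indicators add up.\<close>
  define U where "U = {x. 0 \<le> x \<and> 2 * F i (- x) \<le> t}"
  define V where "V = {x. \<not> (x < 0 \<and> 2 * F i x \<le> t)}"
  show thesis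
  proof (rule that[of U V])
    show "y \<in> U" if "x \<in> U" "x \<le> y" for x y
      using F[of "- y" "- x"] that by (auto simp: U_def)
    show "y \<in> V" if "x \<in> V" "x \<le> y" for x y
      using F[of x y] that by (auto simp: V_def)
    show "U \<in> sets borel" "V \<in> sets borel"
      unfolding U_def V_def by measurable
    show "rejected s F t z h i = indicator U (z i - h i) + 1 - indicator V (z i - h i)" for z h
    proof -
      have "(if 2 * F i (- \<bar>y\<bar>) \<le> t then 1 else 0) = indicator U y + 1 - (indicator V y :: real)" for y
        by (cases "0 \<le> y") (auto simp: U_def V_def indicator_def)
      then show ?thesis by (simp add: rejected_def adj_pval_def Two_Sided)
    qed
  qed
qed

section \<open>Expectations with respect to a random vector\<close>

lemma rand_vec_measurable:
  assumes "\<And>i. i \<in> {1..m} \<Longrightarrow> X i \<in> borel_measurable M"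
  shows "rand_vec m X \<in> M \<rightarrow>\<^sub>M vec_space m"
  unfolding vec_space_def rand_vec_def[abs_def] by (intro measurable_restrict assms)

lemma expect_wrt_sum:
  assumes M: "prob_space M" and X[measurable]: "\<And>i. i \<in> {1..m} \<Longrightarrow> X i \<in> borel_measurable M"
    and J: "J \<subseteq> {1..m}" and f: "\<And>i. i \<in> J \<Longrightarrow> f i \<in> borel_measurable borel"
    and bound: "\<And>i x. i \<in> J \<Longrightarrow> \<bar>f i x\<bar> \<le> B"
  shows "expect_wrt M m X (\<lambda>x. \<Sum>i\<in>J. f i (x i)) = (\<Sum>i\<in>J. \<integral>\<omega>. f i (X i \<omega>) \<partial>M)"
proof -
  interpret M: prob_space M by fact
  have [measurable]: "(\<lambda>x. f i (x i)) \<in> borel_measurable (vec_space m)" if "i \<in> J" for i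
  proof -
    have "(\<lambda>x. x i) \<in> borel_measurable (vec_space m)"
      unfolding vec_space_def using that J by (intro measurable_component_singleton) auto
    from measurable_compose[OF this f[OF that]] show ?thesis .
  qed
  have "expect_wrt M m X (\<lambda>x. \<Sum>i\<in>J. f i (x i)) = (\<integral>\<omega>. (\<Sum>i\<in>J. f i (rand_vec m X \<omega> i)) \<partial>M)"
    unfolding expect_wrt_def
    by (rule integral_distr[OF rand_vec_measurable[OF X]]) measurable
  also have "\<dots> = (\<integral>\<omega>. (\<Sum>i\<in>J. f i (X i \<omega>)) \<partial>M)"
    using J by (intro Bochner_Integration.integral_cong sum.cong refl) (auto simp: rand_vec_def)
  also have "\<dots> = (\<Sum>i\<in>J. \<integral>\<omega>. f i (X i \<omega>) \<partial>M)"
  proof (rule Bochner_Integration.integral_sum)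
    fix i assume i: "i \<in> J"
    then have [measurable]: "f i \<in> borel_measurable borel" "X i \<in> borel_measurable M"
      using f X J by auto
    show "integrable M (\<lambda>\<omega>. f i (X i \<omega>))"
      using bound[OF i] by (intro M.integrable_const_bound[of _ B]) auto
  qed
  finally show ?thesis .
qed

lemma expect_wrt_unit_interval:
  assumes M: "prob_space M" and X: "\<And>i. i \<in> {1..m} \<Longrightarrow> X i \<in> borel_measurable M"
    and g: "\<And>x. 0 \<le> g x" "\<And>x. g x \<le> 1"
  shows "0 \<le> expect_wrt M m X g" "expect_wrt M m X g \<le> 1"
proof -
  interpret P: prob_space "distr M (vec_space m) (rand_vec m X)"
    by (intro prob_space.prob_space_distr M rand_vec_measurable X)
  show "0 \<le> expect_wrt M m X g" using g by (simp add: expect_wrt_def)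
  show "expect_wrt M m X g \<le> 1"
  proof (cases "integrable (distr M (vec_space m) (rand_vec m X)) g")
    case True
    then show ?thesis unfolding expect_wrt_def using g by (intro P.integral_le_const) auto
  next
    case False
    \<comment> \<open>The Bochner integral of a non-integrable function is 0, which also lies in the
      unit interval.\<close>
    then show ?thesis by (simp add: expect_wrt_def not_integrable_integral_eq)
  qed
qed

text \<open>False rejections are among all rejections, and the denominator is at least 1.\<close>

lemma FDP_bounds: "0 \<le> FDP s F t m \<mu> z h" "FDP s F t m \<mu> z h \<le> 1"
proof -
  have r: "0 \<le> rejected s F t z h i" for i by (simp add: rejected_def)
  have "num_false_rej s F t m \<mu> z h \<le> num_rej s F t m z h"
    unfolding num_false_rej_def num_rej_def by (rule sum_mono2) (auto simp: true_nulls_def r)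
  then show "FDP s F t m \<mu> z h \<le> 1" by (simp add: FDP_def)
  show "0 \<le> FDP s F t m \<mu> z h"
    using r by (simp add: FDP_def num_false_rej_def sum_nonneg)
qed

text \<open>The index set \<open>J m\<close> is left open so that one argument serves both all
  rejections and the false ones. Each rejection indicator is a combination of two upper-set
  indicators of \<open>v m i\<close>, whose averages converge separately.\<close>

lemma rejection_average_AE:
  fixes \<mu> :: "nat \<Rightarrow> nat \<Rightarrow> real" and \<eta> v \<zeta> :: "nat \<Rightarrow> nat \<Rightarrow> 'a \<Rightarrow> real"
  assumes M: "prob_space M"
    and \<zeta>: "\<And>m i \<omega>. m \<ge> 1 \<Longrightarrow> i \<in> {1..m} \<Longrightarrow> \<omega> \<in> space M \<Longrightarrow> \<zeta> m i \<omega> = \<mu> m i + \<eta> m i \<omega> + v m i \<omega>"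
    and v: "\<And>m. m \<ge> 1 \<Longrightarrow> mv_normal M m (v m) (\<lambda>_. 0) (\<Sigma> m)"
    and C: "(\<lambda>m. matrix_norm1 m (\<lambda>i j. correlation M (v m i) (v m j)) / real m ^ 2)
           \<in> O(\<lambda>m. real m powr (- \<delta>))" and \<delta>: "0 < \<delta>"
    and J: "\<And>m. J m \<subseteq> {1..m}"
  shows "AE \<omega> in M. (\<lambda>m. \<bar>(\<Sum>i\<in>J m. rejected s (null_cdf M (v m)) t (\<lambda>i. \<zeta> m i \<omega>) (\<lambda>i. \<eta> m i \<omega>) i)
      - expect_wrt M m (v m)
          (\<lambda>x. \<Sum>i\<in>J m. rejected s (null_cdf M (v m)) t (\<lambda>i. \<mu> m i + \<eta> m i \<omega> + x i) (\<lambda>i. \<eta> m i \<omega>) i)\<bar>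
      / real m) \<longlonglongrightarrow> 0"
proof -
  interpret M: prob_space M by fact
  have J1: "1 \<le> m" if "i \<in> J m" for m i using J[of m] that by auto
  have meas: "v m i \<in> borel_measurable M" if "i \<in> {1..m}" for m i
    using v[of m] that by (auto simp: mv_normal_def)
  have measJ: "v m i \<in> borel_measurable M" if "i \<in> J m" for m i
    using meas J that by blast
  have "\<forall>m i. \<exists>U V. i \<in> J m \<longrightarrow> (\<forall>x y. x \<in> U \<longrightarrow> x \<le> y \<longrightarrow> y \<in> U) \<and> (\<forall>x y. x \<in> V \<longrightarrow> x \<le> y \<longrightarrow> y \<in> V) \<and>
      U \<in> sets borel \<and> V \<in> sets borel \<and>
      (\<forall>z h. rejected s (null_cdf M (v m)) t z h i = indicator U (z i - h i) + 1 - indicator V (z i - h i))"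
  proof (intro allI)
    fix m i
    show "\<exists>U V. i \<in> J m \<longrightarrow> (\<forall>x y. x \<in> U \<longrightarrow> x \<le> y \<longrightarrow> y \<in> U) \<and> (\<forall>x y. x \<in> V \<longrightarrow> x \<le> y \<longrightarrow> y \<in> V) \<and>
      U \<in> sets borel \<and> V \<in> sets borel \<and>
      (\<forall>z h. rejected s (null_cdf M (v m)) t z h i = indicator U (z i - h i) + 1 - indicator V (z i - h i))"
    proof (cases "i \<in> J m")
      case True
      show ?thesis
        by (rule rejected_decompose[where F = "null_cdf M (v m)" and i = i and s = s and t = t,
              OF null_cdf_mono[OF M, where v = "v m" and i = i, OF measJ[OF True]]
                null_cdf_measurable[OF M, where v = "v m" and i = i, OF measJ[OF True]]]) blast+
    qed simp
  qed
  then obtain U V where UV: "\<And>m i. i \<in> J m \<Longrightarrow>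
      (\<forall>x y. x \<in> U m i \<longrightarrow> x \<le> y \<longrightarrow> y \<in> U m i) \<and> (\<forall>x y. x \<in> V m i \<longrightarrow> x \<le> y \<longrightarrow> y \<in> V m i) \<and>
      U m i \<in> sets borel \<and> V m i \<in> sets borel \<and>
      (\<forall>z h. rejected s (null_cdf M (v m)) t z h i = indicator (U m i) (z i - h i) + 1 - indicator (V m i) (z i - h i))"
    by (simp only: choice_iff) blast
  \<comment> \<open>Subtracting \<open>\<eta>\<close> leaves \<open>\<mu> m i + v m i\<close>; the
    shift by the mean turns the regions into upper sets for \<open>v m i\<close>.\<close>
  define Us where "Us = (\<lambda>m i. {x. \<mu> m i + x \<in> U m i})"
  define Vs where "Vs = (\<lambda>m i. {x. \<mu> m i + x \<in> V m i})"
  have up: "y \<in> Us m i" if "i \<in> J m" "x \<in> Us m i" "x \<le> y" for m i x y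
    using UV[OF that(1), THEN conjunct1, rule_format, of "\<mu> m i + x" "\<mu> m i + y"] that by (simp add: Us_def)
  have vp: "y \<in> Vs m i" if "i \<in> J m" "x \<in> Vs m i" "x \<le> y" for m i x y
    using UV[OF that(1), THEN conjunct2, THEN conjunct1, rule_format, of "\<mu> m i + x" "\<mu> m i + y"] that by (simp add: Vs_def)
  have Us[measurable]: "Us m i \<in> sets borel" and Vs[measurable]: "Vs m i \<in> sets borel" if "i \<in> J m" for m i
  proof -
    have [measurable]: "U m i \<in> sets borel" "V m i \<in> sets borel" using UV[OF that] by auto
    show "Us m i \<in> sets borel" "Vs m i \<in> sets borel" unfolding Us_def Vs_def by measurable
  qed
  define r where "r = (\<lambda>m i x. indicator (Us m i) x + 1 - indicator (Vs m i) x :: real)"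
  have rej: "rejected s (null_cdf M (v m)) t z h i = r m i x" if "i \<in> J m" "z i = \<mu> m i + h i + x" for m i z h x
    using UV[OF that(1)] that(2) by (simp add: r_def Us_def Vs_def indicator_def)
  have r_meas: "r m i \<in> borel_measurable borel" if "i \<in> J m" for m i
    using Us[OF that] Vs[OF that] unfolding r_def by measurable
  \<comment> \<open>The right side is free of the outer \<open>\<omega>\<close>: the value of
    \<open>\<eta>\<close> cancels inside the p-value, so the expectation over \<open>v\<close> is a
    constant.\<close>
  have expect: "expect_wrt M m (v m)
      (\<lambda>x. \<Sum>i\<in>J m. rejected s (null_cdf M (v m)) t (\<lambda>i. \<mu> m i + \<eta> m i \<omega> + x i) (\<lambda>i. \<eta> m i \<omega>) i) =
      (\<Sum>i\<in>J m. \<integral>\<omega>. r m i (v m i \<omega>) \<partial>M)" for m \<omega>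
  proof -
    have "expect_wrt M m (v m)
      (\<lambda>x. \<Sum>i\<in>J m. rejected s (null_cdf M (v m)) t (\<lambda>i. \<mu> m i + \<eta> m i \<omega> + x i) (\<lambda>i. \<eta> m i \<omega>) i) =
      expect_wrt M m (v m) (\<lambda>x. \<Sum>i\<in>J m. r m i (x i))"
      by (intro arg_cong[where f = "expect_wrt M m (v m)"] ext sum.cong refl rej) auto
    also have "\<dots> = (\<Sum>i\<in>J m. \<integral>\<omega>. r m i (v m i \<omega>) \<partial>M)"
      by (rule expect_wrt_sum[OF M meas J r_meas, where B = 2]) (auto simp: r_def indicator_def)
    finally show ?thesis .
  qed
  have Er: "(\<integral>\<omega>. r m i (v m i \<omega>) \<partial>M) =
      (\<integral>\<omega>. indicator (Us m i) (v m i \<omega>) \<partial>M) + 1 - (\<integral>\<omega>. indicator (Vs m i) (v m i \<omega>) \<partial>M)" if i: "i \<in> J m" for m i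
  proof -
    note [measurable] = measJ[OF i] Us[OF i] Vs[OF i]
    have "integrable M (\<lambda>\<omega>. indicator (Us m i) (v m i \<omega>) :: real)" "integrable M (\<lambda>\<omega>. indicator (Vs m i) (v m i \<omega>) :: real)"
      by (auto intro!: M.integrable_const_bound[of _ 1] simp: indicator_def)
    then show ?thesis by (simp add: r_def M.prob_space)
  qed
  have "AE \<omega> in M. (\<lambda>m. (\<Sum>i\<in>J m. indicator (Us m i) (v m i \<omega>) -
      (\<integral>\<omega>'. indicator (Us m i) (v m i \<omega>') \<partial>M)) / real m) \<longlonglongrightarrow> 0"
    by (rule mv_normal_upper_set_average_AE[OF M v C \<delta> J up Us])
  moreover have "AE \<omega> in M. (\<lambda>m. (\<Sum>i\<in>J m. indicator (Vs m i) (v m i \<omega>) -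
      (\<integral>\<omega>'. indicator (Vs m i) (v m i \<omega>') \<partial>M)) / real m) \<longlonglongrightarrow> 0"
    by (rule mv_normal_upper_set_average_AE[OF M v C \<delta> J vp Vs])
  moreover note AE_space
  ultimately show ?thesis
  proof eventually_elim
    case (elim \<omega>)
    have "(\<Sum>i\<in>J m. rejected s (null_cdf M (v m)) t (\<lambda>i. \<zeta> m i \<omega>) (\<lambda>i. \<eta> m i \<omega>) i) - (\<Sum>i\<in>J m. \<integral>\<omega>. r m i (v m i \<omega>) \<partial>M) =
      (\<Sum>i\<in>J m. indicator (Us m i) (v m i \<omega>) - (\<integral>\<omega>'. indicator (Us m i) (v m i \<omega>') \<partial>M)) -
      (\<Sum>i\<in>J m. indicator (Vs m i) (v m i \<omega>) - (\<integral>\<omega>'. indicator (Vs m i) (v m i \<omega>') \<partial>M))" for m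
      unfolding sum_subtractf[symmetric]
    proof (rule sum.cong[OF refl])
      fix i assume i: "i \<in> J m"
      have "\<zeta> m i \<omega> = \<mu> m i + \<eta> m i \<omega> + v m i \<omega>"
        using i J[of m] J1[OF i] elim(3) by (intro \<zeta>) auto
      then have "rejected s (null_cdf M (v m)) t (\<lambda>i. \<zeta> m i \<omega>) (\<lambda>i. \<eta> m i \<omega>) i = r m i (v m i \<omega>)"
        by (intro rej i)
      then show "rejected s (null_cdf M (v m)) t (\<lambda>i. \<zeta> m i \<omega>) (\<lambda>i. \<eta> m i \<omega>) i - (\<integral>\<omega>. r m i (v m i \<omega>) \<partial>M) =
        (indicator (Us m i) (v m i \<omega>) - (\<integral>\<omega>'. indicator (Us m i) (v m i \<omega>') \<partial>M)) -
        (indicator (Vs m i) (v m i \<omega>) - (\<integral>\<omega>'. indicator (Vs m i) (v m i \<omega>') \<partial>M))"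
        unfolding Er[OF i] by (simp add: r_def)
    qed
    then show ?case
      unfolding expect using tendsto_rabs[OF tendsto_diff[OF elim(1,2)]]
      by (simp add: diff_divide_distrib[symmetric])
  qed
qed

theorem proposition3:
  fixes M :: "'a measure"
    and \<mu> :: "nat \<Rightarrow> nat \<Rightarrow> real"
    and \<eta> v \<zeta> :: "nat \<Rightarrow> nat \<Rightarrow> 'a \<Rightarrow> real"
    and \<Sigma>\<^sub>\<eta> \<Sigma>\<^sub>v :: "nat \<Rightarrow> nat \<Rightarrow> nat \<Rightarrow> real"
    and t \<delta> :: real
    and \<sigma>\<^sub>0 :: ereal
    and s :: sidedness
  assumes "prob_space M"
    and "0 < t" and "t < 1"
    and "\<And>m i \<omega>. m \<ge> 1 \<Longrightarrow> i \<in> {1..m} \<Longrightarrow> \<omega> \<in> space M \<Longrightarrow>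
           \<zeta> m i \<omega> = \<mu> m i + \<eta> m i \<omega> + v m i \<omega>"
    and "\<And>m. m \<ge> 1 \<Longrightarrow> mv_normal M m (\<eta> m) (\<lambda>_. 0) (\<Sigma>\<^sub>\<eta> m)"
    and "\<And>m. m \<ge> 1 \<Longrightarrow> mv_normal M m (v m) (\<lambda>_. 0) (\<Sigma>\<^sub>v m)"
    and "\<And>m. m \<ge> 1 \<Longrightarrow>
           prob_space.indep_var M (vec_space m) (rand_vec m (\<eta> m)) (vec_space m) (rand_vec m (v m))"
    and "\<And>m i. m \<ge> 1 \<Longrightarrow> i \<in> {1..m} \<Longrightarrow> prob_space.variance M (\<zeta> m i) \<noteq> 0"
    and "(\<lambda>m. INF i\<in>{i \<in> {1..m}. std_dev M (v m i) \<noteq> 0}. ereal (std_dev M (v m i))) \<longlonglongrightarrow> \<sigma>\<^sub>0"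
    and "\<sigma>\<^sub>0 > 0"
    and "\<delta> > 0"
    and "(\<lambda>m. matrix_norm1 m (\<lambda>i j. correlation M (v m i) (v m j)) / real m ^ 2)
           \<in> O(\<lambda>m. real m powr (- \<delta>))"
    and "AE \<omega> in M.
           ((\<lambda>(m, m'). Max {L2_set (\<lambda>i. \<eta> m i \<omega> - \<eta> m' i \<omega>) {1..m},
                            L2_set (\<lambda>i. \<mu> m i - \<mu> m' i) {1..m},
                            L2_set (\<lambda>i. std_dev M (v m i) - std_dev M (v m' i)) {1..m}})
            \<longlongrightarrow> 0) ordered_pairs_at_top"
  shows
    "(AE \<omega> in M.
        (\<lambda>m. \<bar>num_rej s (null_cdf M (v m)) t m (\<lambda>i. \<zeta> m i \<omega>) (\<lambda>i. \<eta> m i \<omega>)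
               - expect_wrt M m (v m)
                   (\<lambda>x. num_rej s (null_cdf M (v m)) t m (\<lambda>i. \<mu> m i + \<eta> m i \<omega> + x i) (\<lambda>i. \<eta> m i \<omega>))\<bar>
              / real m) \<longlonglongrightarrow> 0) \<and>
     (AE \<omega> in M.
        (\<lambda>m. \<bar>num_false_rej s (null_cdf M (v m)) t m (\<mu> m) (\<lambda>i. \<zeta> m i \<omega>) (\<lambda>i. \<eta> m i \<omega>)
               - expect_wrt M m (v m)
                   (\<lambda>x. num_false_rej s (null_cdf M (v m)) t m (\<mu> m)
                          (\<lambda>i. \<mu> m i + \<eta> m i \<omega> + x i) (\<lambda>i. \<eta> m i \<omega>))\<bar>
              / real m) \<longlonglongrightarrow> 0) \<and>
     (liminf (\<lambda>m. ereal (null_prop m (\<mu> m))) > 0 \<longrightarrow>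
      (AE \<omega> in M. \<exists>c>0. \<forall>h :: nat \<Rightarrow> nat \<Rightarrow> real. \<exists>l\<ge>c.
         (\<lambda>m. Min (adj_pval s (null_cdf M (v m)) (\<lambda>i. \<mu> m i + h m i + v m i \<omega>) (h m) ` true_nulls m (\<mu> m)))
           \<longlonglongrightarrow> l) \<longrightarrow>
      (AE \<omega> in M.
        (\<lambda>m. \<bar>FDP s (null_cdf M (v m)) t m (\<mu> m) (\<lambda>i. \<zeta> m i \<omega>) (\<lambda>i. \<eta> m i \<omega>)
               - expect_wrt M m (v m)
                   (\<lambda>x. FDP s (null_cdf M (v m)) t m (\<mu> m)
                          (\<lambda>i. \<mu> m i + \<eta> m i \<omega> + x i) (\<lambda>i. \<eta> m i \<omega>))\<bar>
              / real m) \<longlonglongrightarrow> 0))"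
proof -
  note M = assms(1) and \<zeta> = assms(4) and v = assms(6) and C = assms(12) and \<delta> = assms(11)
  have avg: "AE \<omega> in M. (\<lambda>m. \<bar>(\<Sum>i\<in>J m. rejected s (null_cdf M (v m)) t (\<lambda>i. \<zeta> m i \<omega>) (\<lambda>i. \<eta> m i \<omega>) i)
      - expect_wrt M m (v m)
          (\<lambda>x. \<Sum>i\<in>J m. rejected s (null_cdf M (v m)) t (\<lambda>i. \<mu> m i + \<eta> m i \<omega> + x i) (\<lambda>i. \<eta> m i \<omega>) i)\<bar>
      / real m) \<longlonglongrightarrow> 0" if "\<And>m. J m \<subseteq> {1..m}" for J
    \<comment> \<open>The index sets \<open>{1..m}\<close> and \<open>true_nulls m (\<mu> m)\<close>
      will give the claims on all and on false rejections.\<close>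
    by (rule rejection_average_AE[OF M \<zeta> v C \<delta> that])
  have FDP_small: "AE \<omega> in M. (\<lambda>m. \<bar>FDP s (null_cdf M (v m)) t m (\<mu> m) (\<lambda>i. \<zeta> m i \<omega>) (\<lambda>i. \<eta> m i \<omega>)
       - expect_wrt M m (v m)
           (\<lambda>x. FDP s (null_cdf M (v m)) t m (\<mu> m)
                  (\<lambda>i. \<mu> m i + \<eta> m i \<omega> + x i) (\<lambda>i. \<eta> m i \<omega>))\<bar>
      / real m) \<longlonglongrightarrow> 0"
  \<comment> \<open>The proportion and its expectation both lie in the unit interval, so the
    quotient is squeezed between 0 and \<open>1 / m\<close> at every
    \<open>\<omega>\<close>.\<close>
  proof (rule AE_I2, rule tendsto_sandwich[OF _ _ tendsto_const lim_inverse_n'])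
    fix \<omega>
    show "\<forall>\<^sub>F m in sequentially. \<bar>FDP s (null_cdf M (v m)) t m (\<mu> m) (\<lambda>i. \<zeta> m i \<omega>) (\<lambda>i. \<eta> m i \<omega>)
       - expect_wrt M m (v m)
           (\<lambda>x. FDP s (null_cdf M (v m)) t m (\<mu> m)
                  (\<lambda>i. \<mu> m i + \<eta> m i \<omega> + x i) (\<lambda>i. \<eta> m i \<omega>))\<bar>
      / real m \<le> 1 / real m"
      using eventually_ge_at_top[of 1]
    proof eventually_elim
      case (elim m)
      have X: "v m i \<in> borel_measurable M" if "i \<in> {1..m}" for i
        using v[OF elim] that by (auto simp: mv_normal_def)
      show ?case
        using expect_wrt_unit_interval[OF M X FDP_bounds] FDP_bounds
        by (intro divide_right_mono) (auto simp: abs_le_iff add_increasing2 diff_le_eq intro: order_trans)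
    qed
  qed simp
  have nulls: "true_nulls m (\<mu> m) \<subseteq> {1..m}" for m by (auto simp: true_nulls_def)
  show ?thesis
    unfolding num_rej_def num_false_rej_def
    using avg[of "\<lambda>m. {1..m}", OF subset_refl] avg[of "\<lambda>m. true_nulls m (\<mu> m)", OF nulls]
      FDP_small by blast
qed

end
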